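(* Let $X$ be a compact $3$-dimensional topological stratified pseudomanifold, with natural subsets $X(0)\subset X(1)\subset X$. For any triangulation $h\colon X\to|K|$ of $X$, the sets $h(X(0))$ and $h(X(1))$ are the polytopes of, respectively, $0$-dimensional and $1$-dimensional subcomplexes of $K$.
   Context: Let $c(Z)=Z\times[0,1)/(Z\times\{0\})$ denote the open cone on a space $Z$, with $c(\emptyset)$ a point. The following definition is recursive in the dimension. A topological stratified pseudomanifold $X$ of dimension $n$ is a paracompact Hausdorff space with a filtration $X=X_n\supset X_{n-1}=X_{n-2}\supset X_{n-3}\supset\cdots\supset X_0\supset X_{-1}=\emptyset$ such that: (1) each stratum $S_{n-k}=X_{n-k}-X_{n-k-1}$ is either empty or a topological manifold of dimension $n-k$; (2) $X-X_{n-2}$ is dense in $X$; (3) each $x\in S_{n-k}$ has a neighborhood $U$ in $X$ (a distinguished neighborhood) with a homeomorphism $h\colon U\to D^{n-k}\times c(L)$, where $D^{n-k}$ is an open ball neighborhood of $x$ in $S_{n-k}$ and $L$ (the link of $x$) is a compact topological stratified pseudomanifold of dimension $k-1$, and $h$ takes $U\cap X_{n-j}$ homeomorphically onto $D^{n-k}\times c(L_{k-j-1})$. A triangulation of $X$ is a homeomorphism $h\colon X\to|K|$ with $K$ a (finite) simplicial complex; the polytope of a complex is its underlying space. For a compact $3$-dimensional pseudomanifold $X$: $X(1)$ is the set of points of $X$ having no open neighborhood in $X$ homeomorphic to the open ball $D^3$; $X(0)$ is the set of points of $X(1)$ that also have no open neighborhood homeomorphic to $D^1\times c(\coprod S^1)$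 for a (nonempty, finite) disjoint union of circles $\coprod S^1$. The subcomplexes may be empty, and a "$1$-dimensional subcomplex" is a graph in which isolated vertices are allowed (so it is a subcomplex of dimension at most $1$). *)

theory Defs
  imports "HOL-Analysis.Analysis"
begin

section \<open>Open cones\<close>

text \<open>The open cone \<open>c(Z) = Z \<times> [0,1) / (Z \<times> {0})\<close>, with \<open>None\<close> as the cone point and
  \<open>Some (z, t)\<close>, \<open>0 < t < 1\<close>, as the class of \<open>(z, t)\<close>. The cone point is also present when
  \<open>Z\<close> is empty; then the cone is a single point.\<close>

definition cone_proj :: "'a \<times> real \<Rightarrow> ('a \<times> real) option" where
  "cone_proj p = (if snd p = 0 then None else Some p)"

definition cone_set :: "'a set \<Rightarrow> ('a \<times> real) option set" where
  "cone_set A = insert None (cone_proj ` (A \<times> {0..<1}))"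

abbreviation half_open_cylinder :: "'a topology \<Rightarrow> ('a \<times> real) topology" where
  "half_open_cylinder Z \<equiv> prod_topology Z (top_of_set {0..<1})"

definition open_cone :: "'a topology \<Rightarrow> ('a \<times> real) option topology" where
  "open_cone Z = topology (\<lambda>W. W \<subseteq> cone_set (topspace Z) \<and>
     openin (half_open_cylinder Z) {p \<in> topspace (half_open_cylinder Z). cone_proj p \<in> W})"

lemma istopology_open_cone:
  "istopology (\<lambda>W. W \<subseteq> cone_set (topspace Z) \<and>
     openin (half_open_cylinder Z) {p \<in> topspace (half_open_cylinder Z). cone_proj p \<in> W})"
proof -
  let ?C = "half_open_cylinder Z"
  have 1: "{p \<in> topspace ?C. cone_proj p \<in> S \<inter> T} =
      {p \<in> topspace ?C. cone_proj p \<in> S} \<inter> {p \<in> topspace ?C. cone_proj p \<in> T}" for S T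
    by auto
  have 2: "{p \<in> topspace ?C. cone_proj p \<in> \<Union>\<K>} =
      (\<Union>K\<in>\<K>. {p \<in> topspace ?C. cone_proj p \<in> K})" for \<K>
    by auto
  show ?thesis
    unfolding istopology_def 1 2 by blast
qed

lemma openin_open_cone:
  "openin (open_cone Z) W \<longleftrightarrow> W \<subseteq> cone_set (topspace Z) \<and>
     openin (half_open_cylinder Z) {p \<in> topspace (half_open_cylinder Z). cone_proj p \<in> W}"
  unfolding open_cone_def by (simp only: topology_inverse'[OF istopology_open_cone])

lemma topspace_open_cone: "topspace (open_cone Z) = cone_set (topspace Z)"
proof -
  have "{p \<in> topspace (half_open_cylinder Z). cone_proj p \<in> cone_set (topspace Z)} =
      topspace (half_open_cylinder Z)"
    by (auto simp: cone_set_def)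
  then have "openin (open_cone Z) (cone_set (topspace Z))"
    unfolding openin_open_cone by (simp only: openin_topspace order_refl)
  moreover have "topspace (open_cone Z) \<subseteq> cone_set (topspace Z)"
    using openin_open_cone[THEN iffD1, OF openin_topspace] by (rule conjunct1)
  ultimately show ?thesis
    using openin_subset by (metis subset_antisym)
qed

lemma quotient_map_cone_proj:
  assumes "topspace Z \<noteq> {}"
  shows "quotient_map (half_open_cylinder Z) (open_cone Z) cone_proj"
proof -
  obtain z where z: "z \<in> topspace Z"
    using assms by blast
  then have "None \<in> cone_proj ` (topspace Z \<times> {0..<1})"
    by (intro image_eqI[of _ _ "(z, 0)"]) (simp_all add: cone_proj_def)
  then have "cone_proj ` topspace (half_open_cylinder Z) = topspace (open_cone Z)"
    by (auto simp: topspace_open_cone cone_set_def)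
  then show ?thesis
    unfolding quotient_map_def openin_open_cone topspace_open_cone by blast
qed


section \<open>Balls, manifolds, paracompactness\<close>

definition open_disc :: "nat \<Rightarrow> (nat \<Rightarrow> real) topology" where
  "open_disc d = subtopology (Euclidean_space d) {x. (\<Sum>i<d. (x i)\<^sup>2) < 1}"

definition topological_manifold :: "nat \<Rightarrow> 'a topology \<Rightarrow> bool" where
  "topological_manifold d M \<longleftrightarrow>
     Hausdorff_space M \<and> second_countable M \<and>
     (\<forall>x \<in> topspace M. \<exists>V. openin M V \<and> x \<in> V \<and>
        subtopology M V homeomorphic_space Euclidean_space d)"

definition paracompact_space :: "'a topology \<Rightarrow> bool" where
  "paracompact_space X \<longleftrightarrow>
     (\<forall>\<U>. (\<forall>U \<in> \<U>. openin X U) \<and> \<Union>\<U> = topspace X \<longrightarrow>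
        (\<exists>\<V>. (\<forall>V \<in> \<V>. openin X V \<and> (\<exists>U \<in> \<U>. V \<subseteq> U)) \<and> \<Union>\<V> = topspace X \<and>
              locally_finite_in X \<V>))"


section \<open>Topological stratified pseudomanifolds\<close>

text \<open>A filtration is a family \<open>F\<close> indexed by the integers, of which only the members up to the
  dimension \<open>n\<close> matter; those of negative index are empty.
  \<open>distinguished_nbhd X F n k x L G U D h\<close> says that \<open>U\<close> is a neighbourhood of the point \<open>x\<close> of
  the stratum of codimension \<open>k\<close>, and that \<open>h\<close> maps it homeomorphically to the product of the
  open ball neighbourhood \<open>D\<close> of \<open>x\<close> in that stratum with the cone on \<open>L\<close>, compatibly with the
  filtrations \<open>F\<close> of \<open>X\<close> and \<open>G\<close> of \<open>L\<close>. For \<open>j = k\<close> the relevant member of \<open>G\<close> has index \<open>-1\<close>,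
  so that its cone is the cone point.\<close>

definition distinguished_nbhd ::
  "'a topology \<Rightarrow> (int \<Rightarrow> 'a set) \<Rightarrow> int \<Rightarrow> int \<Rightarrow> 'a \<Rightarrow> 'b topology \<Rightarrow> (int \<Rightarrow> 'b set) \<Rightarrow>
   'a set \<Rightarrow> 'a set \<Rightarrow> ('a \<Rightarrow> 'a \<times> ('b \<times> real) option) \<Rightarrow> bool" where
  "distinguished_nbhd X F n k x L G U D h \<longleftrightarrow>
     U \<subseteq> topspace X \<and> (\<exists>V. openin X V \<and> x \<in> V \<and> V \<subseteq> U) \<and>
     openin (subtopology X (F (n - k) - F (n - k - 1))) D \<and> x \<in> D \<and>
     subtopology X D homeomorphic_space open_disc (nat (n - k)) \<and>
     homeomorphic_map (subtopology X U) (prod_topology (subtopology X D) (open_cone L)) h \<and>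
     (\<forall>j \<in> {0..k}.
        homeomorphic_map (subtopology X (U \<inter> F (n - j)))
          (prod_topology (subtopology X D) (open_cone (subtopology L (G (k - j - 1))))) h)"

text \<open>The recursion on the dimension is expressed by an inductive predicate. It starts with
  dimension \<open>-1\<close>, where the only pseudomanifold is the empty space (the link of a point of the
  top stratum). Links are taken as topologies on the type \<open>'a\<close> of points of \<open>X\<close>. This is no
  restriction: if the cone on \<open>L\<close> times \<open>D\<close> is homeomorphic to a subspace of \<open>X\<close>, then so is
  \<open>{d} \<times> L \<times> {1/2}\<close>, hence every link has a homeomorphic copy inside \<open>X\<close>.\<close>

inductive stratified_pseudomanifold :: "int \<Rightarrow> 'a topology \<Rightarrow> (int \<Rightarrow> 'a set) \<Rightarrow> bool" where
  "stratified_pseudomanifold n X F"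
  if "-1 \<le> n"
    and "paracompact_space X" and "Hausdorff_space X"
    and "F n = topspace X" and "\<forall>i \<in> {0..n}. F (i - 1) \<subseteq> F i"
    and "F (n - 1) = F (n - 2)" and "\<forall>i < 0. F i = {}"
    and "\<forall>k \<in> {0..n}. F (n - k) - F (n - k - 1) = {} \<or>
           topological_manifold (nat (n - k)) (subtopology X (F (n - k) - F (n - k - 1)))"
    and "X closure_of (topspace X - F (n - 2)) = topspace X"
    and "\<forall>k \<in> {0..n}. \<forall>x \<in> F (n - k) - F (n - k - 1).
           \<exists>L G. stratified_pseudomanifold (k - 1) L G \<and> compact_space L \<and>
             (\<exists>U D h. distinguished_nbhd X F n k x L G U D h)"


section \<open>The intrinsic subsets of a 3-dimensional pseudomanifold\<close>

text \<open>\<open>singular_1 X\<close> and \<open>singular_0 X\<close> are the sets \<open>X(1)\<close> and \<open>X(0)\<close>; the disjoint union of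
  \<open>m\<close> circles is \<open>sum_topology (\<lambda>_. nsphere 1) {..<m}\<close>.\<close>

definition singular_1 :: "'a topology \<Rightarrow> 'a set" where
  "singular_1 X = {x \<in> topspace X.
     \<not> (\<exists>U. openin X U \<and> x \<in> U \<and> subtopology X U homeomorphic_space open_disc 3)}"

definition singular_0 :: "'a topology \<Rightarrow> 'a set" where
  "singular_0 X = {x \<in> singular_1 X.
     \<not> (\<exists>U m. openin X U \<and> x \<in> U \<and> 1 \<le> m \<and>
          subtopology X U homeomorphic_space
            prod_topology (open_disc 1)
              (open_cone (sum_topology (\<lambda>_::nat. nsphere 1) {..<m})))}"


section \<open>Subcomplexes\<close>

text \<open>In \<^const>\<open>simplicial_complex\<close> the empty set counts as a simplex, of dimension \<open>-1\<close>; it does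
  not affect underlying spaces.\<close>

definition subcomplex :: "'b::euclidean_space set set \<Rightarrow> 'b set set \<Rightarrow> bool" where
  "subcomplex L K \<longleftrightarrow> L \<subseteq> K \<and> simplicial_complex L"

end

theory Submission
  imports Defs
begin

text \<open>Translations identify small neighbourhoods in the polytope of any two points of the relative
  interior of the same simplex, since a simplex is conical near each of its points. So
  whether a point has arbitrarily small neighbourhoods of a given kind depends only on its carrier
  simplex. A simplex of dimension at least 2 has a relatively interior point off the 1-skeleton \<open>F 1\<close> of the
  stratification, because \<open>F 0\<close> is discrete and \<open>F 1\<close> embeds locally in the line away from \<open>F 0\<close>
  (invariance of dimension); so its relative interior misses \<open>X(1)\<close>. An edge has a
  relatively interior point off \<open>F 0\<close>, which is either a manifold point or has a distinguished
  neighbourhood \<open>D\<^sup>1 \<times> c(L)\<close> with \<open>L\<close> a nonempty compact 1-manifold, that is, a finite disjoint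
  union of circles; so its relative interior misses \<open>X(0)\<close>. Finally, \<open>X(1)\<close> is closed.\<close>

section \<open>Compact 1-manifolds\<close>

text \<open>The definitions of \<open>X(0)\<close> and \<open>X(1)\<close> ask for a single
  neighbourhood, but the translations act only near a point, so what is transported is the existence
  of arbitrarily small ones. For balls the two notions agree. For a disc times a cone, smallness is
  proved on the axis through the cone point, where the cone on a compact space is self-similar; this
  suffices, since the aim is only to exhibit neighbourhoods for the points of an edge. The
  stratification supplies one good point in each relative interior and homogeneity carries it to the
  others. The two halves then differ: the carrier of a point of \<open>X(0)\<close> is that point
  alone, while for \<open>X(1)\<close> homogeneity fills the relative interior and closedness adds
  the boundary. The link is an abstract space, whereas the circles come from a classification of
  compact 1-manifolds inside a Euclidean space. Level \<open>1/2\<close> of the cone, followed by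
  the triangulation, embeds the link there. The link is nonempty because \<open>X - F 1\<close> is
  dense, and a manifold because its own filtration satisfies
  \<open>G 0 = G (-1) = {}\<close>.\<close>

lemma connected_Int_clopen_empty:
  fixes S :: "'a::topological_space set"
  assumes "connected T" "T \<subseteq> S" "openin (top_of_set S) B" "closedin (top_of_set S) B" "a \<in> T" "a \<notin> B"
  shows "T \<inter> B = {}"
proof -
  obtain U where U: "open U" "B = S \<inter> U"
    using assms(3) by (auto simp: openin_open)
  obtain V where V: "closed V" "B = S \<inter> V"
    using assms(4) by (auto simp: closedin_closed)
  have "T \<inter> B = T \<inter> U" "T \<inter> B = T \<inter> V"
    using U(2) V(2) assms(2) by auto
  then have "openin (top_of_set T) (T \<inter> B)" "closedin (top_of_set T) (T \<inter> B)"
    using U(1) V(1) by (auto simp: openin_open closedin_closed)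
  then show ?thesis
    using \<open>connected T\<close> assms(5,6) unfolding connected_clopen by blast
qed

text \<open>If every \<open>p \<noteq> a\<close> were a cut point, choose \<open>B p\<close> clopen in \<open>C - {p}\<close> with \<open>a \<notin> B p\<close>. Then
  \<open>q \<in> B p\<close> implies \<open>B q \<union> {q} \<subseteq> B p\<close>, so the compact sets \<open>B p \<union> {p}\<close> have no minimal element,
  contradicting Zorn's lemma (applied to their complements \<open>D p\<close>).\<close>

proposition compact_connected_noncut_point:
  fixes C :: "'a::heine_borel set"
  assumes "compact C" "connected C" "a \<in> C" "C \<noteq> {a}"
  obtains p where "p \<in> C" "p \<noteq> a" "connected (C - {p})"
proof (rule ccontr)
  note witness = that
  assume "\<not> thesis"
  have cut: "\<not> connected (C - {p})" if "p \<in> C - {a}" for p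
    using \<open>\<not> thesis\<close> witness that by blast
  have "\<exists>B. openin (top_of_set (C - {p})) B \<and> closedin (top_of_set (C - {p})) B \<and> B \<noteq> {} \<and> a \<notin> B"
    if p: "p \<in> C - {a}" for p
  proof -
    obtain T where T: "openin (top_of_set (C - {p})) T" "closedin (top_of_set (C - {p})) T"
      "T \<noteq> {}" "T \<noteq> C - {p}"
      using cut[OF p] unfolding connected_clopen by blast
    have "T \<subseteq> C - {p}"
      using T(1) openin_imp_subset by blast
    \<comment> \<open>Both sides of the separation are clopen, so the one that misses
      \<open>a\<close> can serve as \<open>B p\<close>.\<close>
    have "openin (top_of_set (C - {p})) (C - {p} - T)" "closedin (top_of_set (C - {p})) (C - {p} - T)"
      using T by (auto simp: openin_diff closedin_diff)
    then show ?thesis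
      using T \<open>T \<subseteq> C - {p}\<close> by (cases "a \<in> T") blast+
  qed
  then obtain B where B: "\<And>p. p \<in> C - {a} \<Longrightarrow> openin (top_of_set (C - {p})) (B p)"
      "\<And>p. p \<in> C - {a} \<Longrightarrow> closedin (top_of_set (C - {p})) (B p)"
      "\<And>p. p \<in> C - {a} \<Longrightarrow> B p \<noteq> {}" "\<And>p. p \<in> C - {a} \<Longrightarrow> a \<notin> B p"
    by metis
  have Bsub: "B p \<subseteq> C - {p}" if "p \<in> C - {a}" for p
    using B(1)[OF that] openin_imp_subset by blast
  have cpt: "compact (insert p (B p))" if p: "p \<in> C - {a}" for p
  proof -
    obtain T where "closed T" "B p = (C - {p}) \<inter> T"
      using B(2)[OF p] by (auto simp: closedin_closed)
    then have "insert p (B p) = C \<inter> insert p T"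
      using p by auto
    then show ?thesis
      using \<open>closed T\<close> \<open>compact C\<close> by (simp add: compact_Int_closed closed_insert)
  qed
  have nest: "insert q (B q) \<subseteq> B p" if p: "p \<in> C - {a}" and q: "q \<in> B p" for p q
  proof -
    have qC: "q \<in> C - {a}" "q \<noteq> p"
      using p q Bsub B(4) by blast+
    let ?A = "C - {p} - B p"
    have "openin (top_of_set (C - {p})) ?A" "closedin (top_of_set (C - {p})) ?A"
      using B(1,2)[OF p] by (auto simp: openin_diff closedin_diff)
    \<comment> \<open>Putting \<open>p\<close> back joins the clopen remainder \<open>?A\<close>
      into a connected set. It contains \<open>a\<close> and avoids \<open>q\<close>, so it cannot
      cross the separation of \<open>C - {q}\<close> and misses \<open>B q\<close>.\<close>
    then have "connected ({p} \<union> ?A)"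
      using connected_Un_clopen_in_complement[of "{p}" C ?A] p assms by auto
    then have "({p} \<union> ?A) \<inter> B q = {}"
      using connected_Int_clopen_empty[of "{p} \<union> ?A" "C - {q}" "B q" a] B[OF qC(1)] B(4)[OF p]
        q qC p assms(3) by blast
    then show ?thesis
      using q Bsub[OF qC(1)] by blast
  qed
  define D where "D p = C - insert p (B p)" for p
  have Dmono: "D p \<subset> D q" if "p \<in> C - {a}" "q \<in> B p" for p q
  proof -
    have "p \<in> D q" "p \<notin> D p" 
      using nest[OF that] Bsub[OF that(1)] that by (auto simp: D_def)
    then show ?thesis
      using nest[OF that] unfolding D_def by blast
  qed
  have "\<exists>M \<in> D ` (C - {a}). \<forall>X \<in> D ` (C - {a}). M \<subseteq> X \<longrightarrow> X = M"
  proof (rule Zorn_Lemma2, rule ballI)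
    fix c assume c: "c \<in> chains (D ` (C - {a}))"
    show "\<exists>U \<in> D ` (C - {a}). \<forall>X \<in> c. X \<subseteq> U"
    proof (cases "\<exists>U \<in> c. \<forall>X \<in> c. X \<subseteq> U")
      case True
      then show ?thesis
        using chainsD2[OF c] by (meson subsetD)
    next
      case no_max: False
      define P where "P = {p \<in> C - {a}. D p \<in> c}"
      have c_eq: "c = D ` P"
        using chainsD2[OF c] by (auto simp: P_def)
      show ?thesis
      proof (cases "P = {}")
        case True
        show ?thesis
        proof -
          \<comment> \<open>The empty chain needs some member as a bound;
            \<open>C \<noteq> {a}\<close> provides one.\<close>
          obtain p where "p \<in> C - {a}"
            using assms(3,4) by auto
          then show ?thesis
            using c_eq True by blast
        qed
      next
        case False
        let ?E = "\<lambda>p. insert p (B p)"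
        have DE: "?E p = C - D p" if "p \<in> P" for p
        proof -
          have "p \<in> C - {a}"
            using that by (simp add: P_def)
          then show ?thesis
            using Bsub[of p] unfolding D_def by blast
        qed
        have "\<Inter>(?E ` P) \<noteq> {}"
        proof (rule compact_chain)
          show "\<And>S. S \<in> ?E ` P \<Longrightarrow> compact S"
            using cpt by (auto simp: P_def)
          show "S \<subseteq> T \<or> T \<subseteq> S" if ST: "S \<in> ?E ` P \<and> T \<in> ?E ` P" for S T
          proof -
            obtain p q where pq: "p \<in> P" "q \<in> P" "S = ?E p" "T = ?E q"
              using ST by blast
            then have "D p \<subseteq> D q \<or> D q \<subseteq> D p"
              using chainsD[OF c, of "D p" "D q"] by (simp add: P_def)
            then show ?thesis
              using pq DE by blast
          qed
        qed auto
        then obtain r where r: "\<And>p. p \<in> P \<Longrightarrow> r \<in> ?E p"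
          by blast
        \<comment> \<open>As the chain has no largest member, every \<open>p\<close> is strictly
          surpassed by some \<open>q\<close> of \<open>P\<close>, which lies in \<open>B p\<close>.
          Hence \<open>?E q\<close> lies inside \<open>B p\<close>, and the common point
          \<open>r\<close> is in \<open>B p\<close> rather than possibly equal to \<open>p\<close>;
          so \<open>D r\<close> bounds the chain.\<close>
        have rB: "r \<in> B p" if p: "p \<in> P" for p
        proof -
          obtain q where q: "q \<in> P" "\<not> D q \<subseteq> D p"
            using no_max p c_eq by blast
          then have "D p \<subseteq> D q"
            using chainsD[OF c, of "D p" "D q"] p by (auto simp: P_def)
          then have "?E q \<subseteq> ?E p"
            using DE p q by blast
          then have "q \<in> B p"
            using q by blast
          then show ?thesis
            using nest[of p q] r[OF q(1)] p by (auto simp: P_def)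
        qed
        then have "D p \<subseteq> D r" if "p \<in> P" for p
          using that Dmono[of p r] by (auto simp: P_def)
        moreover have "r \<in> C - {a}"
        proof -
          obtain p where "p \<in> P"
            using False by blast
          then show ?thesis
            using rB[of p] Bsub[of p] B(4)[of p] by (auto simp: P_def)
        qed
        ultimately have "\<forall>X \<in> c. X \<subseteq> D r" "D r \<in> D ` (C - {a})"
          unfolding c_eq by auto
        then show ?thesis
          by (rule bexI)
      qed
    qed
  qed
  then obtain p where p: "p \<in> C - {a}" and max: "\<And>q. q \<in> C - {a} \<Longrightarrow> D p \<subseteq> D q \<Longrightarrow> D q = D p"
    by blast
  obtain q where q: "q \<in> B p"
    using B(3)[OF p] by blast
  then have "q \<in> C - {a}"
    using Bsub[OF p] B(4)[OF p] by blast
  then show False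
    using max Dmono[OF p q] by blast
qed

text \<open>A 1-manifold without boundary, given as a subset: for a subset of a Euclidean space the
  Hausdorff and countability conditions are inherited.\<close>

definition locally_line :: "'a::topological_space set \<Rightarrow> bool" where
  "locally_line S \<longleftrightarrow>
     (\<forall>x\<in>S. \<exists>V. openin (top_of_set S) V \<and> x \<in> V \<and> V homeomorphic (UNIV :: real set))"

lemma locally_lineE:
  assumes "locally_line S" "x \<in> S"
  obtains V f g where "openin (top_of_set S) V" "x \<in> V" "homeomorphism V (UNIV :: real set) f g"
  using assms unfolding locally_line_def homeomorphic_def by meson

text \<open>A small interval around the image of the point under a chart pulls back into the open
  subset, and an interval is again homeomorphic to the line.\<close>

lemma locally_line_openin:
  assumes S: "locally_line S" and V: "openin (top_of_set S) V"
  shows "locally_line V"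
  unfolding locally_line_def
proof
  fix x assume "x \<in> V"
  then have "x \<in> S"
    using V openin_imp_subset by blast
  then obtain W f g where W: "openin (top_of_set S) W" "x \<in> W"
    and fg: "homeomorphism W (UNIV :: real set) f g"
    using locally_lineE[OF S] by metis
  have "openin (top_of_set W) (V \<inter> W)"
    using openin_subset_trans[OF openin_Int[OF V W(1)]] W(1) openin_imp_subset by blast
  then have "open (f ` (V \<inter> W))"
    using homeomorphism_imp_open_map[OF fg] by simp
  moreover have "f x \<in> f ` (V \<inter> W)"
    using W(2) \<open>x \<in> V\<close> by blast
  ultimately obtain e where e: "e > 0" "ball (f x) e \<subseteq> f ` (V \<inter> W)"
    by (meson open_contains_ball)
  let ?N = "g ` ball (f x) e"
  have sub: "?N \<subseteq> V \<inter> W"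
    using e(2) fg by (force simp: homeomorphism_def)
  have "openin (top_of_set W) ?N"
    using homeomorphism_imp_open_map[OF homeomorphism_symD[OF fg], of "ball (f x) e"] by simp
  then have "openin (top_of_set S) ?N"
    using W(1) openin_trans by blast
  then have "openin (top_of_set V) ?N"
    using openin_subset_trans sub V openin_imp_subset by (metis le_infE)
  moreover have "x \<in> ?N"
    using fg W(2) e(1) by (auto simp: homeomorphism_def intro!: image_eqI[of _ _ "f x"])
  moreover have "?N homeomorphic (UNIV :: real set)"
  proof -
    have "homeomorphism (ball (f x) e) ?N g f"
      by (rule homeomorphism_of_subsets[OF homeomorphism_symD[OF fg]]) auto
    then have "ball (f x) e homeomorphic ?N"
      unfolding homeomorphic_def by blast
    moreover have "ball (f x) e homeomorphic (UNIV :: real set)"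
      using homeomorphic_ball_UNIV[OF e(1)] .
    ultimately show ?thesis
      using homeomorphic_sym homeomorphic_trans by blast
  qed
  ultimately show "\<exists>N. openin (top_of_set V) N \<and> x \<in> N \<and> N homeomorphic (UNIV :: real set)"
    by blast
qed

lemma locally_line_imp_locally_path_connected:
  fixes S :: "'a::real_normed_vector set"
  assumes S: "locally_line S"
  shows "locally path_connected S"
  unfolding locally_def
proof (intro allI impI, elim conjE)
  fix w x assume w: "openin (top_of_set S) w" and x: "x \<in> w"
  obtain V where V: "openin (top_of_set w) V" "x \<in> V" "V homeomorphic (UNIV :: real set)"
    using locally_line_openin[OF S w] x unfolding locally_line_def by blast
  have "path_connected V"
    using homeomorphic_path_connectedness[OF V(3)] convex_imp_path_connected convex_UNIV by blast
  then show "\<exists>u v. openin (top_of_set S) u \<and> path_connected v \<and> x \<in> u \<and> u \<subseteq> v \<and> v \<subseteq> w"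
    using openin_trans[OF V(1) w] V(2) openin_imp_subset[OF V(1)] by blast
qed

text \<open>Removing a non-cut point \<open>p\<close> leaves a path connected set, in which an arc joins the two sides of
  a chart at \<open>p\<close>; the piece of the chart through \<open>p\<close> closes it up.\<close>

lemma compact_connected_line_has_loop:
  fixes C :: "'a::euclidean_space set"
  assumes "compact C" "connected C" and line: "locally_line C" and "C \<noteq> {}"
  obtains \<gamma> where "simple_path \<gamma>" "pathfinish \<gamma> = pathstart \<gamma>" "path_image \<gamma> \<subseteq> C"
proof -
  obtain x where x: "x \<in> C"
    using \<open>C \<noteq> {}\<close> by blast
  have "C \<noteq> {x}"
  proof
    assume C: "C = {x}"
    obtain V f g where "openin (top_of_set C) V" "homeomorphism V (UNIV :: real set) f g"
      using locally_lineE[OF line x] by metis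
    then have "V \<subseteq> C" "g 0 \<in> V" "g 1 \<in> V" "f (g 0) = 0" "f (g 1) = 1"
      using openin_imp_subset by (blast, auto simp: homeomorphism_def)
    then show False
      unfolding C by (metis singletonD subsetD zero_neq_one)
  qed
  then obtain p where p: "p \<in> C" "connected (C - {p})"
    using compact_connected_noncut_point[OF assms(1,2) x] by metis
  have "openin (top_of_set C) (C - {p})"
    by (simp add: openin_delete)
  then have "locally path_connected (C - {p})"
    using locally_line_imp_locally_path_connected[OF line] locally_open_subset by blast
  then have "path_component_set (C - {p}) y = C - {p}" if "y \<in> C - {p}" for y
    using p(2) that openin_path_component_locally_path_connected[of "C - {p}" y]
      closedin_path_component_locally_path_connected[of "C - {p}" y] path_component_eq_empty[of "C - {p}" y]
    unfolding connected_clopen by blast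
  then have pc: "path_connected (C - {p})"
    by (simp add: path_connected_component_set)
  obtain V f \<psi> where V: "openin (top_of_set C) V" "p \<in> V"
    and hom: "homeomorphism V (UNIV :: real set) f \<psi>"
    using locally_lineE[OF line p(1)] by metis
  have VC: "V \<subseteq> C"
    using V(1) openin_imp_subset by blast
  define c where "c = f p"
  have \<psi>: "continuous_on UNIV \<psi>" "\<And>t. f (\<psi> t) = t" "\<psi> c = p" "\<And>t. \<psi> t \<in> C"
    using hom V(2) VC by (auto simp: homeomorphism_def c_def)
  have \<psi>_inj: "\<psi> s = \<psi> t \<longleftrightarrow> s = t" for s t
    using \<psi>(2) by metis
  have "\<psi> (c - 1) \<in> C - {p}" "\<psi> (c + 1) \<in> C - {p}"
    using \<psi>(4) \<psi>_inj[of _ c] \<psi>(3) by auto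
  then obtain g where g: "path g" "path_image g \<subseteq> C - {p}" "pathstart g = \<psi> (c - 1)"
      "pathfinish g = \<psi> (c + 1)"
    using pc unfolding path_connected_def by blast
  have "closed (\<psi> -` path_image g)"
    using closed_vimage[OF closed_path_image[OF g(1)] \<psi>(1)] .
  then have "open (- (\<psi> -` path_image g))"
    by (rule open_Compl)
  moreover have "c \<in> - (\<psi> -` path_image g)"
    using \<psi>(3) g(2) by auto
  ultimately obtain \<delta> where \<delta>: "\<delta> > 0" "ball c \<delta> \<subseteq> - (\<psi> -` path_image g)"
    using open_contains_ball by blast
  \<comment> \<open>Being below \<open>\<delta>\<close> keeps the closing piece of the chart off
    \<open>g\<close>; being below 1 makes the outer pieces, from \<open>c - \<epsilon>\<close> to
    \<open>c - 1\<close> and from \<open>c + 1\<close> to \<open>c + \<epsilon>\<close>, meet it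
    only at its ends.\<close>
  define \<epsilon> where "\<epsilon> = min (\<delta> / 2) (1 / 2)"
  have \<epsilon>: "0 < \<epsilon>" "\<epsilon> < 1" "\<epsilon> < \<delta>"
    using \<delta>(1) by (auto simp: \<epsilon>_def)
  have g_avoid: "\<psi> t \<notin> path_image g" if "\<bar>t - c\<bar> < \<delta>" for t
    using \<delta>(2) that by (force simp: dist_real_def)
  define L where "L a b = \<psi> \<circ> linepath a b" for a b :: real
  have L_path: "path (L a b)" for a b
    unfolding L_def by (intro path_continuous_image path_linepath continuous_on_subset[OF \<psi>(1)]) auto
  have L_image: "path_image (L a b) = \<psi> ` closed_segment a b" for a b
    by (simp add: L_def path_image_compose)
  have L_ends: "pathstart (L a b) = \<psi> a" "pathfinish (L a b) = \<psi> b" for a b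
    by (simp_all add: L_def pathstart_compose pathfinish_compose)
  define k where "k = L (c - \<epsilon>) (c - 1) +++ g +++ L (c + 1) (c + \<epsilon>)"
  have "path k" "pathstart k = \<psi> (c - \<epsilon>)" "pathfinish k = \<psi> (c + \<epsilon>)"
    by (simp_all add: k_def g L_path L_ends)
  \<comment> \<open>The path \<open>k\<close> may cross itself, as nothing keeps \<open>g\<close>
    away from the outer pieces of the chart. Passing to an arc inside its image preserves both the
    end points and the disjointness from the middle piece.\<close>
  then obtain q where q: "arc q" "path_image q \<subseteq> path_image k" "pathstart q = \<psi> (c - \<epsilon>)"
      "pathfinish q = \<psi> (c + \<epsilon>)"
    using path_contains_arc[of k "\<psi> (c - \<epsilon>)" "\<psi> (c + \<epsilon>)"] \<psi>_inj \<epsilon>(1) by auto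
  have k_image: "path_image k = \<psi> ` {c - 1..c - \<epsilon>} \<union> path_image g \<union> \<psi> ` {c + \<epsilon>..c + 1}"
    using \<epsilon> by (simp add: k_def path_image_join g L_path L_ends L_image closed_segment_eq_real_ivl Un_assoc)
  define r where "r = L (c + \<epsilon>) (c - \<epsilon>)"
  have r_image: "path_image r = \<psi> ` {c - \<epsilon>..c + \<epsilon>}"
    using \<epsilon> by (simp add: r_def L_image closed_segment_eq_real_ivl)
  have r_ends: "pathstart r = \<psi> (c + \<epsilon>)" "pathfinish r = \<psi> (c - \<epsilon>)"
    by (simp_all add: r_def L_ends)
  have "arc r"
    unfolding arc_def
  proof
    have "inj_on (linepath (c + \<epsilon>) (c - \<epsilon>)) {0..1}"
      using \<epsilon>(1) by (intro arc_imp_inj_on arc_linepath) simp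
    then show "inj_on r {0..1}"
      unfolding r_def L_def by (rule comp_inj_on) (simp add: inj_on_def \<psi>_inj)
  qed (simp add: r_def L_path)
  moreover have "path_image q \<inter> path_image r \<subseteq> {pathstart q, pathstart r}"
  proof
    fix z assume z: "z \<in> path_image q \<inter> path_image r"
    then obtain t where t: "z = \<psi> t" "c - \<epsilon> \<le> t" "t \<le> c + \<epsilon>"
      by (auto simp: r_image)
    have "z \<notin> path_image g"
      using g_avoid[of t] t \<epsilon>(3) by auto
    then have "t \<le> c - \<epsilon> \<or> c + \<epsilon> \<le> t"
      using z q(2) unfolding k_image t(1) by (auto simp: \<psi>_inj)
    then show "z \<in> {pathstart q, pathstart r}"
      using t by (auto simp: q r_ends)
  qed
  ultimately have "simple_path (q +++ r)"
    using simple_path_join_loop[OF q(1)] q r_ends by simp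
  moreover have "path_image k \<subseteq> C"
    unfolding k_image using g(2) \<psi>(4) by auto
  then have "path_image (q +++ r) \<subseteq> C"
    using q r_ends \<psi>(4) by (auto simp: path_image_join r_image)
  moreover have "pathfinish (q +++ r) = pathstart (q +++ r)"
    by (simp add: q r_ends)
  ultimately show thesis
    using that by blast
qed

text \<open>Invariance of domain in dimension one: near each of its points the circle is carried
  continuously and injectively into a chart, so its image is open in the line and hence in
  \<open>C\<close>.\<close>

lemma openin_circle_in_line:
  fixes C :: "'a::euclidean_space set"
  assumes line: "locally_line C" and J: "J homeomorphic sphere (0::complex) 1" "J \<subseteq> C"
  shows "openin (top_of_set C) J"
proof (subst openin_subopen, intro ballI)
  fix y assume y: "y \<in> J"
  obtain V f g where V: "openin (top_of_set C) V" "y \<in> V"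
    and fg: "homeomorphism V (UNIV :: real set) f g"
    using locally_lineE[OF line, of y] y J(2) by blast
  obtain j k where jk: "homeomorphism (sphere (0::complex) 1) J j k"
    using J(1) homeomorphic_sym unfolding homeomorphic_def by blast
  have ope: "openin (top_of_set J) (J \<inter> V)"
    using V(1) J(2) by (metis inf.absorb_iff2 openin_subtopology_Int2 subtopology_subtopology)
  have "openin (top_of_set (sphere 0 1)) (k ` (J \<inter> V))"
    using homeomorphism_imp_open_map[OF homeomorphism_symD[OF jk] ope] .
  moreover have "continuous_on (k ` (J \<inter> V)) (f \<circ> j)"
  proof (rule continuous_on_compose)
    have "k ` (J \<inter> V) \<subseteq> sphere 0 1" "j ` k ` (J \<inter> V) \<subseteq> V"
      using jk by (auto simp: homeomorphism_def)
    then show "continuous_on (k ` (J \<inter> V)) j" "continuous_on (j ` k ` (J \<inter> V)) f"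
      using jk fg continuous_on_subset unfolding homeomorphism_def by metis+
  qed
  moreover have "inj_on (f \<circ> j) (k ` (J \<inter> V))"
    using jk fg unfolding homeomorphism_def inj_on_def by (auto; metis)
  ultimately have "openin (top_of_set UNIV) ((f \<circ> j) ` (k ` (J \<inter> V)))"
    using invariance_of_domain_sphere_affine_set[of "k ` (J \<inter> V)" "f \<circ> j" UNIV 1 0] by simp
  moreover have "(f \<circ> j) ` (k ` (J \<inter> V)) = f ` (J \<inter> V)"
    using jk by (force simp: homeomorphism_def image_image)
  ultimately have "openin (top_of_set V) (g ` f ` (J \<inter> V))"
    using homeomorphism_imp_open_map[OF homeomorphism_symD[OF fg]] by simp
  moreover have "g ` f ` (J \<inter> V) = J \<inter> V"
    using fg by (force simp: homeomorphism_def image_image)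
  ultimately have "openin (top_of_set C) (J \<inter> V)"
    using V(1) openin_trans by force
  then show "\<exists>T. openin (top_of_set C) T \<and> y \<in> T \<and> T \<subseteq> J"
    using y V(2) by blast
qed

text \<open>A simple loop in \<open>C\<close> is open by invariance of domain and closed by
  compactness, so by connectedness it is all of \<open>C\<close>.\<close>

proposition compact_connected_line_homeomorphic_circle:
  fixes C :: "'a::euclidean_space set"
  assumes "compact C" "connected C" "locally_line C" "C \<noteq> {}"
  shows "C homeomorphic sphere (0::complex) 1"
proof -
  obtain \<gamma> where \<gamma>: "simple_path \<gamma>" "pathfinish \<gamma> = pathstart \<gamma>" "path_image \<gamma> \<subseteq> C"
    using compact_connected_line_has_loop[OF assms] .
  have circle: "path_image \<gamma> homeomorphic sphere (0::complex) 1"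
    using homeomorphic_simple_path_image_circle[OF \<gamma>(1,2)] by simp
  have "openin (top_of_set C) (path_image \<gamma>)"
    by (rule openin_circle_in_line[OF assms(3) circle \<gamma>(3)])
  moreover have "closedin (top_of_set C) (path_image \<gamma>)"
    using \<gamma> by (simp add: closed_subset closed_path_image simple_path_imp_path)
  ultimately have "path_image \<gamma> = C"
    using \<open>connected C\<close> path_image_nonempty unfolding connected_clopen by blast
  with circle show ?thesis by simp
qed

section \<open>From circles in Euclidean space to topological sums of standard spheres\<close>

lemma homeomorphic_iff_homeomorphic_space:
  "S homeomorphic T \<longleftrightarrow> top_of_set S homeomorphic_space top_of_set T"
proof -
  have "homeomorphism S T f g \<longleftrightarrow> homeomorphic_maps (top_of_set S) (top_of_set T) f g" for f g
  proof
    assume "homeomorphism S T f g"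
    then show "homeomorphic_maps (top_of_set S) (top_of_set T) f g"
      unfolding homeomorphism_def homeomorphic_maps_def by (auto simp: continuous_map_in_subtopology)
  next
    assume "homeomorphic_maps (top_of_set S) (top_of_set T) f g"
    then show "homeomorphism S T f g"
      unfolding homeomorphic_maps_def
      by (intro homeomorphismI) (auto simp: continuous_map_in_subtopology)
  qed
  then show ?thesis
    unfolding homeomorphic_def homeomorphic_space_def by blast
qed

lemma nsphere_1_homeomorphic_circle: "nsphere 1 homeomorphic_space top_of_set (sphere (0::complex) 1)"
proof -
  let ?f = "\<lambda>x. Complex (x 0) (x 1)"
  let ?g = "\<lambda>z (i::nat). if i = 0 then Re z else if i = 1 then Im z else 0"
  have "homeomorphic_maps (nsphere 1) (top_of_set (sphere 0 1)) ?f ?g"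
    unfolding homeomorphic_maps_def
  proof (intro conjI ballI)
    have "continuous_map (nsphere 1) euclidean (\<lambda>x. (x 0, x 1))"
      using continuous_map_nsphere_projection[of 1]
      by (simp add: continuous_map_pairedI flip: euclidean_product_topology prod_topology_euclidean)
    moreover have "continuous_map euclidean euclidean (\<lambda>p. Complex (fst p) (snd p))"
      by (auto simp: Complex_eq intro!: continuous_intros)
    ultimately have "continuous_map (nsphere 1) euclidean ((\<lambda>p. Complex (fst p) (snd p)) \<circ> (\<lambda>x. (x 0, x 1)))"
      by (rule continuous_map_compose)
    then show "continuous_map (nsphere 1) (top_of_set (sphere 0 1)) ?f"
      unfolding continuous_map_in_subtopology by (auto simp: nsphere cmod_def o_def)
    show "continuous_map (top_of_set (sphere 0 1)) (nsphere 1) ?g"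
      unfolding nsphere continuous_map_in_subtopology continuous_map_componentwise_UNIV
    proof (intro conjI allI)
      show "continuous_map (top_of_set (sphere 0 1)) euclideanreal (\<lambda>z. ?g z k)" for k
        by (cases "k = 0"; cases "k = 1") (auto intro!: continuous_intros)
      show "?g \<in> topspace (top_of_set (sphere 0 1)) \<rightarrow> {x. (\<Sum>i\<le>1. (x i)\<^sup>2) = 1 \<and> (\<forall>i>1. x i = 0)}"
        by (auto simp: cmod_def)
    qed
  qed (auto simp: nsphere fun_eq_iff)
  then show ?thesis
    unfolding homeomorphic_space_def by blast
qed

lemma homeomorphic_space_sum_topology_clopen_partition:
  assumes P: "\<And>i. i \<in> I \<Longrightarrow> openin X (P i)" "disjoint_family_on P I" "topspace X = (\<Union>i\<in>I. P i)"
    and hom: "\<And>i. i \<in> I \<Longrightarrow> Y i homeomorphic_space subtopology X (P i)"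
  shows "sum_topology Y I homeomorphic_space X"
proof -
  have "\<forall>i\<in>I. \<exists>f. homeomorphic_map (Y i) (subtopology X (P i)) f"
    using hom unfolding homeomorphic_space by blast
  then obtain f where f: "\<And>i. i \<in> I \<Longrightarrow> homeomorphic_map (Y i) (subtopology X (P i)) (f i)"
    by metis
  have PX: "P i \<subseteq> topspace X" if "i \<in> I" for i
    using openin_subset[OF P(1)[OF that]] .
  have fim: "f i ` topspace (Y i) = P i" if "i \<in> I" for i
    using homeomorphic_imp_surjective_map[OF f[OF that]] PX[OF that] by auto
  let ?F = "\<lambda>(i, y). f i y"
  have "homeomorphic_map (sum_topology Y I) X ?F"
  proof (rule bijective_open_imp_homeomorphic_map)
    show "continuous_map (sum_topology Y I) X ?F"
      unfolding continuous_map_def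
    proof (intro conjI allI impI)
      show "?F \<in> topspace (sum_topology Y I) \<rightarrow> topspace X"
      proof
        fix p assume "p \<in> topspace (sum_topology Y I)"
        then obtain i y where "p = (i, y)" "i \<in> I" "y \<in> topspace (Y i)"
          by auto
        then show "?F p \<in> topspace X"
          using fim[of i] PX[of i] by auto
      qed
      fix U assume U: "openin X U"
      have "openin (Y i) {y \<in> topspace (Y i). f i y \<in> U}" if i: "i \<in> I" for i
        using openin_continuous_map_preimage[OF continuous_map_into_fulltopology[OF
              homeomorphic_imp_continuous_map[OF f[OF i]]] U] .
      moreover have "{y. (i, y) \<in> {p \<in> topspace (sum_topology Y I). ?F p \<in> U}} =
          {y \<in> topspace (Y i). f i y \<in> U}" if "i \<in> I" for i
        using that by auto
      ultimately show "openin (sum_topology Y I) {p \<in> topspace (sum_topology Y I). ?F p \<in> U}"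
        unfolding openin_sum_topology by auto
    qed
    show "open_map (sum_topology Y I) X ?F"
      unfolding open_map_def
    proof (intro allI impI)
      fix U assume U: "openin (sum_topology Y I) U"
      have "openin X (f i ` {y. (i, y) \<in> U})" if i: "i \<in> I" for i
      proof -
        have "openin (Y i) {y. (i, y) \<in> U}"
          using U i unfolding openin_sum_topology by blast
        then have "openin (subtopology X (P i)) (f i ` {y. (i, y) \<in> U})"
          using homeomorphic_imp_open_map[OF f[OF i]] unfolding open_map_def by blast
        then show ?thesis
          using P(1)[OF i] openin_trans_full by blast
      qed
      moreover have "?F ` U = (\<Union>i\<in>I. f i ` {y. (i, y) \<in> U})"
      proof (intro set_eqI iffI)
        fix z assume "z \<in> ?F ` U"
        then obtain i y where iy: "(i, y) \<in> U" "z = f i y"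
          by auto
        then have "i \<in> I"
          using openin_subset[OF U] by auto
        then show "z \<in> (\<Union>i\<in>I. f i ` {y. (i, y) \<in> U})"
          using iy by blast
      next
        fix z assume "z \<in> (\<Union>i\<in>I. f i ` {y. (i, y) \<in> U})"
        then obtain i y where "(i, y) \<in> U" "z = f i y"
          by auto
        then show "z \<in> ?F ` U"
          by (intro image_eqI[of _ _ "(i, y)"]) auto
      qed
      ultimately show "openin X (?F ` U)"
        by auto
    qed
    show "?F ` topspace (sum_topology Y I) = topspace X"
    proof -
      have "?F ` topspace (sum_topology Y I) = (\<Union>i\<in>I. f i ` topspace (Y i))"
        by (auto simp: image_iff intro!: bexI)
      then show ?thesis
        using fim P(3) by simp
    qed
    show "inj_on ?F (topspace (sum_topology Y I))"
    proof (rule inj_onI, clarsimp)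
      fix i y j z
      assume *: "i \<in> I" "y \<in> topspace (Y i)" "j \<in> I" "z \<in> topspace (Y j)" "f i y = f j z"
      then have "f i y \<in> P i \<inter> P j"
        using fim by (metis IntI image_eqI)
      then have "i = j"
        using P(2) * unfolding disjoint_family_on_def by blast
      moreover have "inj_on (f i) (topspace (Y i))"
        using homeomorphic_imp_injective_map[OF f] * by blast
      ultimately show "i = j \<and> y = z"
        using * by (auto dest: inj_onD)
    qed
  qed
  then show ?thesis
    by (rule homeomorphic_map_imp_homeomorphic_space)
qed

text \<open>Local connectedness makes the components open, so compactness leaves only finitely many
  of them; each is a compact connected line and hence a circle.\<close>

theorem compact_line_homeomorphic_circles:
  fixes S :: "'a::euclidean_space set"
  assumes "compact S" and line: "locally_line S" and "S \<noteq> {}"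
  obtains m where "1 \<le> m"
    "top_of_set S homeomorphic_space sum_topology (\<lambda>_::nat. nsphere 1) {..<m}"
proof -
  have comp_open: "openin (top_of_set S) C" if "C \<in> components S" for C
    using openin_components_locally_connected that locally_line_imp_locally_path_connected[OF line]
      locally_path_connected_imp_locally_connected by blast
  have "finite (components S)"
  proof -
    obtain D where D: "D \<subseteq> components S" "finite D" "S \<subseteq> \<Union>D"
      using \<open>compact S\<close> comp_open Union_components[of S] unfolding compact_eq_openin_cover
      by (metis order_refl)
    have "C \<in> D" if C: "C \<in> components S" for C
    proof -
      obtain x where "x \<in> C"
        using in_components_nonempty[OF C] by blast
      moreover obtain C' where "C' \<in> D" "x \<in> C'"
        using D(3) \<open>x \<in> C\<close> in_components_subset[OF C] by blast
      ultimately show ?thesis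
        using components_nonoverlap[OF C, of C'] D(1) by blast
    qed
    then have "components S \<subseteq> D"
      by blast
    then show ?thesis
      using D(2) by (rule finite_subset)
  qed
  then obtain P where P: "bij_betw P {..<card (components S)} (components S)"
    using ex_bij_betw_nat_finite[of "components S"] unfolding atLeast0LessThan by blast
  have "sum_topology (\<lambda>_::nat. nsphere 1) {..<card (components S)} homeomorphic_space top_of_set S"
  proof (rule homeomorphic_space_sum_topology_clopen_partition[where P = P])
    have PC: "P i \<in> components S" if "i \<in> {..<card (components S)}" for i
      using P that by (auto simp: bij_betw_def)
    then show "openin (top_of_set S) (P i)" if "i \<in> {..<card (components S)}" for i
      using comp_open that by blast
    show "disjoint_family_on P {..<card (components S)}"
      unfolding disjoint_family_on_def
    proof (intro ballI impI)
      fix i j assume ij: "i \<in> {..<card (components S)}" "j \<in> {..<card (components S)}" "i \<noteq> j"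
      then have "P i \<noteq> P j"
        using P by (auto simp: bij_betw_def inj_on_def)
      then show "P i \<inter> P j = {}"
        using components_nonoverlap[OF PC[OF ij(1)] PC[OF ij(2)]] by blast
    qed
    show "topspace (top_of_set S) = (\<Union>i\<in>{..<card (components S)}. P i)"
      using P Union_components[of S] by (simp add: bij_betw_def)
    show "nsphere 1 homeomorphic_space subtopology (top_of_set S) (P i)"
      if i: "i \<in> {..<card (components S)}" for i
    proof -
      have "P i homeomorphic sphere (0::complex) 1"
      proof (rule compact_connected_line_homeomorphic_circle)
        show "compact (P i)"
          using \<open>compact S\<close> compact_components PC[OF i] by blast
        show "connected (P i)" "P i \<noteq> {}"
          using in_components_connected in_components_nonempty PC[OF i] by blast+
        show "locally_line (P i)"
          using locally_line_openin[OF line comp_open[OF PC[OF i]]] .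
      qed
      then have "top_of_set (sphere (0::complex) 1) homeomorphic_space top_of_set (P i)"
        using homeomorphic_sym homeomorphic_iff_homeomorphic_space by blast
      moreover have "subtopology (top_of_set S) (P i) = top_of_set (P i)"
        using in_components_subset[OF PC[OF i]] by (simp add: subtopology_subtopology inf_absorb2)
      ultimately show ?thesis
        using nsphere_1_homeomorphic_circle homeomorphic_space_trans by fastforce
    qed
  qed
  moreover have "1 \<le> card (components S)"
    using \<open>finite (components S)\<close> \<open>S \<noteq> {}\<close> by (simp add: Suc_le_eq card_gt_0_iff)
  ultimately show thesis
    using that homeomorphic_space_sym by blast
qed

section \<open>Small neighbourhoods and cones\<close>

text \<open>Only the homeomorphism type \<open>T\<close> is prescribed, not the place of
  \<open>x\<close> in it. Allowing arbitrarily small sets makes the property local: it can be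
  restricted to an open subspace and recovered from it, which a homeomorphism defined only near
  \<open>x\<close> requires.\<close>

definition small_nbhds :: "'a topology \<Rightarrow> 'a \<Rightarrow> 'b topology \<Rightarrow> bool" where
  "small_nbhds X x T \<longleftrightarrow>
     (\<forall>V. openin X V \<and> x \<in> V \<longrightarrow>
        (\<exists>W. openin X W \<and> x \<in> W \<and> W \<subseteq> V \<and> subtopology X W homeomorphic_space T))"

lemma small_nbhdsE:
  assumes "small_nbhds X x T" "openin X V" "x \<in> V"
  obtains W where "openin X W" "x \<in> W" "W \<subseteq> V" "subtopology X W homeomorphic_space T"
  using assms unfolding small_nbhds_def by blast

lemma small_nbhds_homeomorphic_map:
  assumes h: "homeomorphic_map X Y h" and x: "x \<in> topspace X" and small: "small_nbhds X x T"
  shows "small_nbhds Y (h x) T"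
  unfolding small_nbhds_def
proof (intro allI impI, elim conjE)
  fix V assume V: "openin Y V" "h x \<in> V"
  have "openin X {z \<in> topspace X. h z \<in> V}"
    using openin_continuous_map_preimage[OF homeomorphic_imp_continuous_map[OF h] V(1)] .
  then obtain W where W: "openin X W" "x \<in> W" "W \<subseteq> {z \<in> topspace X. h z \<in> V}"
      "subtopology X W homeomorphic_space T"
    using small_nbhdsE[OF small] x V(2) by blast
  have WX: "W \<subseteq> topspace X"
    using W(1) openin_subset by blast
  have "openin Y (h ` W)"
    using homeomorphic_imp_open_map[OF h] W(1) unfolding open_map_def by blast
  moreover have "homeomorphic_map (subtopology X W) (subtopology Y (h ` W)) h"
    using homeomorphic_imp_surjective_map[OF h] WX
    by (intro homeomorphic_map_subtopologies[OF h]) (auto simp: Int_absorb1)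
  then have "subtopology Y (h ` W) homeomorphic_space T"
    using W(4) homeomorphic_map_imp_homeomorphic_space homeomorphic_space_sym homeomorphic_space_trans by blast
  ultimately show "\<exists>W. openin Y W \<and> h x \<in> W \<and> W \<subseteq> V \<and> subtopology Y W homeomorphic_space T"
    using W(2,3) by blast
qed

lemma small_nbhds_homeomorphic_map_iff:
  assumes h: "homeomorphic_map X Y h" and x: "x \<in> topspace X"
  shows "small_nbhds Y (h x) T \<longleftrightarrow> small_nbhds X x T"
proof
  assume R: "small_nbhds Y (h x) T"
  obtain g where g: "homeomorphic_maps X Y h g"
    using h homeomorphic_map_maps by blast
  have "homeomorphic_map Y X g"
    using g homeomorphic_maps_sym homeomorphic_maps_imp_map by blast
  moreover have "g (h x) = x" "h x \<in> topspace Y"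
    using g x by (auto simp: homeomorphic_maps_def continuous_map_def)
  ultimately show "small_nbhds X x T"
    using small_nbhds_homeomorphic_map[OF _ _ R] by metis
qed (rule small_nbhds_homeomorphic_map[OF assms])

lemma small_nbhds_homeomorphic_space:
  assumes "small_nbhds X x T" "T homeomorphic_space T'"
  shows "small_nbhds X x T'"
  using assms homeomorphic_space_trans unfolding small_nbhds_def by meson

text \<open>A distinguished neighbourhood \<open>U\<close> need not be open; it only contains an
  open \<open>V\<close> around \<open>x\<close>. Sets open in \<open>U\<close> become open in
  \<open>X\<close> once they are shrunk into \<open>V\<close>.\<close>

lemma small_nbhds_subtopology:
  assumes V: "openin X V" "x \<in> V" "V \<subseteq> U" and small: "small_nbhds (subtopology X U) x T"
  shows "small_nbhds X x T"
  unfolding small_nbhds_def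
proof (intro allI impI, elim conjE)
  fix V' assume V': "openin X V'" "x \<in> V'"
  have "openin (subtopology X U) (V \<inter> V')"
    using V V' by (metis Int_absorb2 le_infI1 openin_Int openin_subtopology_Int)
  then obtain W where W: "openin (subtopology X U) W" "x \<in> W" "W \<subseteq> V \<inter> V'"
      "subtopology (subtopology X U) W homeomorphic_space T"
    using small_nbhdsE[OF small] V(2) V'(2) by blast
  obtain G where G: "openin X G" "W = G \<inter> U"
    using W(1) by (auto simp: openin_subtopology)
  have "W = G \<inter> V"
    using G(2) W(3) V(3) by blast
  then have "openin X W"
    using G(1) V(1) by blast
  moreover have "subtopology (subtopology X U) W = subtopology X W"
    using W(3) V(3) by (metis inf_absorb2 le_infE order_trans subtopology_subtopology)
  ultimately show "\<exists>W. openin X W \<and> x \<in> W \<and> W \<subseteq> V' \<and> subtopology X W homeomorphic_space T"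
    using W by auto
qed

lemma small_nbhds_openin:
  assumes small: "small_nbhds X x T" and U: "openin X U" "x \<in> U"
  shows "small_nbhds (subtopology X U) x T"
  unfolding small_nbhds_def
proof (intro allI impI, elim conjE)
  fix V assume V: "openin (subtopology X U) V" "x \<in> V"
  then have "openin X V" "V \<subseteq> U"
    using U(1) openin_open_subtopology by blast+
  then obtain W where W: "openin X W" "x \<in> W" "W \<subseteq> V" "subtopology X W homeomorphic_space T"
    using small_nbhdsE[OF small] V(2) by blast
  moreover have "openin (subtopology X U) W" "subtopology (subtopology X U) W = subtopology X W"
    using W(1,3) \<open>V \<subseteq> U\<close> U(1) by (auto simp: openin_open_subtopology subtopology_subtopology inf_absorb2)
  ultimately show "\<exists>W. openin (subtopology X U) W \<and> x \<in> W \<and> W \<subseteq> V \<and>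
      subtopology (subtopology X U) W homeomorphic_space T"
    by metis
qed

lemma small_nbhds_prod_topology:
  assumes A: "small_nbhds A a S" and B: "small_nbhds B b T"
  shows "small_nbhds (prod_topology A B) (a, b) (prod_topology S T)"
  unfolding small_nbhds_def
proof (intro allI impI, elim conjE)
  fix V assume "openin (prod_topology A B) V" "(a, b) \<in> V"
  then obtain P Q where PQ: "openin A P" "openin B Q" "a \<in> P" "b \<in> Q" "P \<times> Q \<subseteq> V"
    unfolding openin_prod_topology_alt by meson
  obtain P' where P': "openin A P'" "a \<in> P'" "P' \<subseteq> P" "subtopology A P' homeomorphic_space S"
    using small_nbhdsE[OF A PQ(1,3)] .
  obtain Q' where Q': "openin B Q'" "b \<in> Q'" "Q' \<subseteq> Q" "subtopology B Q' homeomorphic_space T"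
    using small_nbhdsE[OF B PQ(2,4)] .
  show "\<exists>W. openin (prod_topology A B) W \<and> (a, b) \<in> W \<and> W \<subseteq> V \<and>
      subtopology (prod_topology A B) W homeomorphic_space prod_topology S T"
  proof (intro exI conjI)
    show "openin (prod_topology A B) (P' \<times> Q')"
      using P' Q' by (simp add: openin_prod_Times_iff)
    show "subtopology (prod_topology A B) (P' \<times> Q') homeomorphic_space prod_topology S T"
      unfolding subtopology_Times using P'(4) Q'(4) by (rule homeomorphic_space_prod_topology)
  qed (use P' Q' PQ in auto)
qed

text \<open>Open sets of a cone are recognised by their preimages in the cylinder, so continuity can
  be tested there. Arguing from \<open>openin_open_cone\<close> also covers an empty base, where
  \<open>cone_proj\<close> does not reach the cone point.\<close>

lemma continuous_map_open_cone:
  assumes g: "continuous_map (half_open_cylinder L) (half_open_cylinder M) g"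
    and F: "F \<in> cone_set (topspace L) \<rightarrow> cone_set (topspace M)"
    and eq: "\<And>p. p \<in> topspace (half_open_cylinder L) \<Longrightarrow> F (cone_proj p) = cone_proj (g p)"
  shows "continuous_map (open_cone L) (open_cone M) F"
  unfolding continuous_map_def topspace_open_cone
proof (intro conjI allI impI F)
  fix U assume "openin (open_cone M) U"
  then have "openin (half_open_cylinder M) {p \<in> topspace (half_open_cylinder M). cone_proj p \<in> U}"
    unfolding openin_open_cone by blast
  then have "openin (half_open_cylinder L)
      {p \<in> topspace (half_open_cylinder L). g p \<in> {p \<in> topspace (half_open_cylinder M). cone_proj p \<in> U}}"
    by (rule openin_continuous_map_preimage[OF g])
  moreover have "{p \<in> topspace (half_open_cylinder L).
        g p \<in> {p \<in> topspace (half_open_cylinder M). cone_proj p \<in> U}} =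
      {p \<in> topspace (half_open_cylinder L). cone_proj p \<in> {c \<in> cone_set (topspace L). F c \<in> U}}"
  proof (rule Collect_cong)
    fix p
    show "p \<in> topspace (half_open_cylinder L) \<and>
        g p \<in> {p \<in> topspace (half_open_cylinder M). cone_proj p \<in> U} \<longleftrightarrow>
      p \<in> topspace (half_open_cylinder L) \<and> cone_proj p \<in> {c \<in> cone_set (topspace L). F c \<in> U}"
      using eq[of p] g by (auto simp: cone_set_def continuous_map_def Pi_iff)
  qed
  ultimately show "openin (open_cone L) {c \<in> cone_set (topspace L). F c \<in> U}"
    unfolding openin_open_cone by auto
qed

section \<open>Points, functoriality and self-similarity of open cones\<close>

lemma cone_set_iff:
  "None \<in> cone_set A" "Some (a, t) \<in> cone_set A \<longleftrightarrow> a \<in> A \<and> 0 < t \<and> t < 1"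
  by (auto simp: cone_set_def cone_proj_def image_iff split: if_splits)

lemma cone_set_cases:
  assumes "c \<in> cone_set A"
  obtains "c = None" | a t where "c = Some (a, t)" "a \<in> A" "0 < t" "t < 1"
  using assms cone_set_iff by (cases c) force+

lemma open_cone_homeomorphic_space:
  assumes "L homeomorphic_space M"
  shows "open_cone L homeomorphic_space open_cone M"
proof -
  obtain f g where fg: "homeomorphic_maps L M f g"
    using assms unfolding homeomorphic_space_def by blast
  let ?F = "\<lambda>f. map_option (map_prod f id)"
  have cont: "continuous_map (open_cone A) (open_cone B) (?F k)" if k: "continuous_map A B k"
    for A :: "'x topology" and B :: "'y topology" and k
  proof (rule continuous_map_open_cone)
    show "continuous_map (half_open_cylinder A) (half_open_cylinder B) (map_prod k id)"
      using k by (simp add: map_prod_def continuous_map_prod_top)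
    show "?F k \<in> cone_set (topspace A) \<rightarrow> cone_set (topspace B)"
      using k by (auto elim!: cone_set_cases simp: cone_set_iff continuous_map_def)
  qed (auto simp: cone_proj_def)
  have "homeomorphic_maps (open_cone L) (open_cone M) (?F f) (?F g)"
    unfolding homeomorphic_maps_def
  proof (intro conjI)
    show "continuous_map (open_cone L) (open_cone M) (?F f)" "continuous_map (open_cone M) (open_cone L) (?F g)"
      using fg cont by (auto simp: homeomorphic_maps_def)
  qed (use fg in \<open>auto simp: topspace_open_cone homeomorphic_maps_def elim!: cone_set_cases\<close>)
  then show ?thesis
    unfolding homeomorphic_space_def by blast
qed

text \<open>Shrinking the radial coordinate by a factor \<open>\<epsilon>\<close> maps the cone
  homeomorphically onto an open subcone of height \<open>\<epsilon>\<close>. Compactness of the base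
  enters through the tube lemma, which gives one height that fits into \<open>V\<close> over all
  points of \<open>L\<close>.\<close>

lemma small_nbhds_open_cone_apex:
  assumes "compact_space L"
  shows "small_nbhds (open_cone L) None (open_cone L)"
  unfolding small_nbhds_def
proof (intro allI impI, elim conjE)
  let ?Y = "half_open_cylinder L"
  fix V assume V: "openin (open_cone L) V" "None \<in> V"
  let ?P = "{p \<in> topspace ?Y. cone_proj p \<in> V}"
  have P: "openin ?Y ?P"
    using V(1) unfolding openin_open_cone by blast
  have "topspace L \<times> {0} \<subseteq> ?P"
    using V(2) by (auto simp: cone_proj_def)
  then obtain A J where AJ: "openin (top_of_set {0..<1::real}) J" "topspace L \<subseteq> A" "0 \<in> J" "A \<times> J \<subseteq> ?P"
    using tube_lemma_left[OF P, of "topspace L" 0] assms by (auto simp: compact_space_def)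
  obtain G where G: "open G" "J = {0..<1} \<inter> G"
    using AJ(1) by (auto simp: openin_open)
  obtain \<delta> where \<delta>: "\<delta> > 0" "ball 0 \<delta> \<subseteq> G"
    using G AJ(3) open_contains_ball by blast
  define \<epsilon> where "\<epsilon> = min \<delta> (1 / 2)"
  have \<epsilon>: "0 < \<epsilon>" "\<epsilon> < 1" "\<epsilon> \<le> \<delta>"
    using \<delta>(1) by (auto simp: \<epsilon>_def)
  have inP: "(a, t) \<in> ?P" if "a \<in> topspace L" "0 \<le> t" "t < \<epsilon>" for a t
  proof -
    have "t \<in> ball 0 \<delta>" "t < 1"
      using that \<epsilon> by auto
    then have "t \<in> J"
      using \<delta>(2) G(2) that by auto
    then show ?thesis
      using AJ(2,4) that by blast
  qed
  define F where "F = map_option (map_prod (id :: 'a \<Rightarrow> 'a) (\<lambda>t. \<epsilon> * t))"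
  have F_simps [simp]: "F None = None" "F (Some (a, t)) = Some (a, \<epsilon> * t)" for a t
    by (simp_all add: F_def)
  have small: "\<epsilon> * t < 1" if "0 < t" "t < 1" for t
    using mult_strict_mono[of \<epsilon> 1 t 1] \<epsilon> that by simp
  have cont: "continuous_map (open_cone L) (open_cone L) F"
  proof (rule continuous_map_open_cone)
    have "continuous_map (top_of_set {0..<1}) (top_of_set {0..<1}) (\<lambda>t. \<epsilon> * t)"
      using \<epsilon> small by (auto simp: continuous_map_in_subtopology Pi_iff le_less intro!: continuous_intros)
    then show "continuous_map ?Y ?Y (map_prod id (\<lambda>t. \<epsilon> * t))"
      by (simp add: map_prod_def continuous_map_prod_top id_def)
    show "F \<in> cone_set (topspace L) \<rightarrow> cone_set (topspace L)"
      using \<epsilon> small by (auto elim!: cone_set_cases simp: cone_set_iff)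
  qed (use \<epsilon> in \<open>auto simp: cone_proj_def\<close>)
  have inj: "inj_on F (topspace (open_cone L))"
    using \<epsilon>(1) by (auto simp: inj_on_def topspace_open_cone elim!: cone_set_cases)
  have op: "open_map (open_cone L) (open_cone L) F"
    unfolding open_map_def
  proof (intro allI impI)
    fix U assume U: "openin (open_cone L) U"
    have UL: "U \<subseteq> cone_set (topspace L)"
      using U unfolding openin_open_cone by blast
    \<comment> \<open>To see that \<open>F\<close> is open, sets are pulled back along division by
      \<open>\<epsilon>\<close>. This leaves \<open>[0,1)\<close>, so the open set is first extended
      to \<open>Q\<close> in the product with all of the reals; cutting down to values below 1
      afterwards selects exactly the heights below \<open>\<epsilon>\<close>.\<close>
    have "?Y = subtopology (prod_topology L euclideanreal) (topspace L \<times> {0..<1})"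
      by (simp add: prod_topology_subtopology)
    then obtain Q where Q: "openin (prod_topology L euclideanreal) Q"
        "{p \<in> topspace ?Y. cone_proj p \<in> U} = Q \<inter> topspace L \<times> {0..<1}"
      using U unfolding openin_open_cone by (auto simp: openin_subtopology)
    have k: "continuous_map ?Y (prod_topology L euclideanreal) (\<lambda>p. (fst p, snd p / \<epsilon>))"
    proof (intro continuous_map_pairedI continuous_map_fst)
      have "continuous_map ?Y euclideanreal snd"
        using continuous_map_snd[of L "top_of_set {0..<1}"] continuous_map_into_fulltopology by blast
      then show "continuous_map ?Y euclideanreal (\<lambda>p. snd p / \<epsilon>)"
        using \<epsilon>(1) by (intro continuous_intros) auto
    qed
    have "openin ?Y {p \<in> topspace ?Y. (fst p, snd p / \<epsilon>) \<in> Q \<inter> topspace L \<times> {..<1}}"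
      using Q(1) by (intro openin_continuous_map_preimage[OF k] openin_Int)
        (auto simp: openin_prod_Times_iff)
    moreover have "{p \<in> topspace ?Y. (fst p, snd p / \<epsilon>) \<in> Q \<inter> topspace L \<times> {..<1}} =
      {p \<in> topspace ?Y. cone_proj p \<in> F ` U}"
    proof (rule Collect_cong, clarify)
      fix p :: "'a \<times> real"
      obtain a t where p: "p = (a, t)" by fastforce
      show "p \<in> topspace ?Y \<and> (fst p, snd p / \<epsilon>) \<in> Q \<inter> topspace L \<times> {..<1} \<longleftrightarrow>
          p \<in> topspace ?Y \<and> cone_proj p \<in> F ` U"
      proof (cases "a \<in> topspace L \<and> 0 \<le> t \<and> t < 1")
        case True
        have "(a, t / \<epsilon>) \<in> Q \<inter> topspace L \<times> {..<1} \<longleftrightarrow>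
            (a, t / \<epsilon>) \<in> {p \<in> topspace ?Y. cone_proj p \<in> U}"
          unfolding Q(2) using True \<epsilon>(1) by auto
        also have "\<dots> \<longleftrightarrow> t < \<epsilon> \<and> cone_proj (a, t / \<epsilon>) \<in> U"
          using True \<epsilon>(1) by auto
        also have "\<dots> \<longleftrightarrow> cone_proj (a, t) \<in> F ` U"
        proof
          assume "t < \<epsilon> \<and> cone_proj (a, t / \<epsilon>) \<in> U"
          moreover have "cone_proj (a, t) = F (cone_proj (a, t / \<epsilon>))"
            using \<epsilon>(1) by (simp add: cone_proj_def)
          ultimately show "cone_proj (a, t) \<in> F ` U"
            by blast
        next
          assume "cone_proj (a, t) \<in> F ` U"
          then obtain u where u: "u \<in> U" "cone_proj (a, t) = F u"
            by blast
          then have "u \<in> cone_set (topspace L)"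
            using UL by blast
          then show "t < \<epsilon> \<and> cone_proj (a, t / \<epsilon>) \<in> U"
            using u \<epsilon> by (cases rule: cone_set_cases) (auto simp: cone_proj_def split: if_splits)
        qed
        finally show ?thesis
          using True by (simp add: p)
      qed (auto simp: p)
    qed
    moreover have "F ` U \<subseteq> cone_set (topspace L)"
      using UL continuous_map_image_subset_topspace[OF cont] unfolding topspace_open_cone by blast
    ultimately show "openin (open_cone L) (F ` U)"
      unfolding openin_open_cone by simp
  qed
  let ?W = "F ` topspace (open_cone L)"
  have "embedding_map (open_cone L) (open_cone L) F"
    by (rule injective_open_imp_embedding_map[OF cont op inj])
  then have "open_cone L homeomorphic_space subtopology (open_cone L) ?W"
    using embedding_map_imp_homeomorphic_space by blast
  then have "subtopology (open_cone L) ?W homeomorphic_space open_cone L"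
    by (rule homeomorphic_space_sym[THEN iffD1])
  moreover have "openin (open_cone L) ?W"
    using op unfolding open_map_def by blast
  moreover have "None \<in> ?W"
    unfolding topspace_open_cone using cone_set_iff(1) F_simps(1) by (metis image_eqI)
  moreover have "?W \<subseteq> V"
  proof
    fix w assume "w \<in> ?W"
    then obtain c where c: "c \<in> cone_set (topspace L)" "w = F c"
      by (auto simp: topspace_open_cone)
    then show "w \<in> V"
    proof (cases rule: cone_set_cases)
      case (2 a t)
      then have "\<epsilon> * t < \<epsilon>" "0 < \<epsilon> * t"
        using \<epsilon>(1) by auto
      then show ?thesis
        using inP[of a "\<epsilon> * t"] 2 c(2) \<epsilon> by (auto simp: cone_proj_def split: if_splits)
    qed (use V(2) c(2) in simp)
  qed
  ultimately show "\<exists>W. openin (open_cone L) W \<and> None \<in> W \<and> W \<subseteq> V \<and>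
      subtopology (open_cone L) W homeomorphic_space open_cone L"
    by blast
qed

section \<open>Local homogeneity of simplicial complexes\<close>

lemma openin_Euclidean_space_ball:
  assumes V: "openin (Euclidean_space d) V" and x: "x \<in> V"
  obtains \<epsilon> where "\<epsilon> > 0"
    "\<And>y. y \<in> topspace (Euclidean_space d) \<Longrightarrow> (\<Sum>i<d. (y i - x i)\<^sup>2) < \<epsilon>\<^sup>2 \<Longrightarrow> y \<in> V"
proof -
  obtain G where G: "openin (powertop_real UNIV) G" "V = G \<inter> {x. \<forall>i\<ge>d. x i = 0}"
    using V by (auto simp: Euclidean_space_def openin_subtopology)
  obtain B where B: "x \<in> (\<Pi>\<^sub>E i\<in>UNIV. B i)" "\<And>i. open (B i)" "(\<Pi>\<^sub>E i\<in>UNIV. B i) \<subseteq> G"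
    using product_topology_open_contains_basis[OF G(1), of x] x G(2) by auto
  have "\<exists>e>0. ball (x i) e \<subseteq> B i" for i
    using B(1,2) open_contains_ball by (metis PiE_mem UNIV_I)
  then obtain e where e: "\<And>i. e i > 0" "\<And>i. ball (x i) (e i) \<subseteq> B i"
    by metis
  \<comment> \<open>The extra 1 keeps the minimum meaningful for \<open>d = 0\<close>. Coordinates
    from \<open>d\<close> on vanish and impose no bound.\<close>
  define \<epsilon> where "\<epsilon> = Min (insert 1 (e ` {..<d}))"
  have \<epsilon>: "\<epsilon> > 0" "\<And>i. i < d \<Longrightarrow> \<epsilon> \<le> e i"
    using e(1) by (auto simp: \<epsilon>_def)
  show thesis
  proof (rule that[OF \<epsilon>(1)])
    fix y assume y: "y \<in> topspace (Euclidean_space d)" "(\<Sum>i<d. (y i - x i)\<^sup>2) < \<epsilon>\<^sup>2"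
    have "y i \<in> B i" for i
    proof (cases "i < d")
      case True
      then have "(y i - x i)\<^sup>2 \<le> (\<Sum>i<d. (y i - x i)\<^sup>2)"
        by (intro member_le_sum) auto
      then have "(y i - x i)\<^sup>2 < \<epsilon>\<^sup>2"
        using y(2) by simp
      then have "\<bar>y i - x i\<bar> < \<epsilon>"
        using \<epsilon>(1) power2_less_imp_less[of "\<bar>y i - x i\<bar>" \<epsilon>] by simp
      then show ?thesis
        using e(2)[of i] \<epsilon>(2)[OF True] by (auto simp: dist_real_def subset_iff abs_minus_commute)
    next
      case False
      then have "y i = x i"
        using y(1) x G(2) by (simp add: topspace_Euclidean_space)
      then show ?thesis
        using B(1) by auto
    qed
    then show "y \<in> V"
      using B(3) G(2) y(1) by (auto simp: topspace_Euclidean_space)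
  qed
qed

lemma continuous_map_into_Euclidean_space:
  "continuous_map X (Euclidean_space d) f \<longleftrightarrow>
     (\<forall>i. continuous_map X euclideanreal (\<lambda>x. f x i)) \<and> (\<forall>x\<in>topspace X. \<forall>i\<ge>d. f x i = 0)"
  by (auto simp: Euclidean_space_def continuous_map_in_subtopology continuous_map_componentwise_UNIV Pi_iff)

lemma continuous_map_Euclidean_space_projection:
  "continuous_map (Euclidean_space d) euclideanreal (\<lambda>x. x i)"
  unfolding Euclidean_space_def by (intro continuous_map_from_subtopology continuous_map_product_projection) simp

lemma openin_Euclidean_space_round:
  "openin (Euclidean_space d) {y \<in> topspace (Euclidean_space d). (\<Sum>i<d. (y i - x i)\<^sup>2) < r}"
proof -
  have "continuous_map (Euclidean_space d) euclideanreal (\<lambda>y. \<Sum>i<d. (y i - x i)\<^sup>2)"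
    by (intro continuous_intros continuous_map_Euclidean_space_projection) auto
  then show ?thesis
    using openin_continuous_map_preimage[of _ euclideanreal _ "{..<r}"] by fastforce
qed

lemma small_nbhds_Euclidean_space:
  assumes x: "x \<in> topspace (Euclidean_space d)"
  shows "small_nbhds (Euclidean_space d) x (open_disc d)"
  unfolding small_nbhds_def
proof (intro allI impI, elim conjE)
  let ?E = "Euclidean_space d"
  fix V assume "openin ?E V" "x \<in> V"
  then obtain \<epsilon> where \<epsilon>: "\<epsilon> > 0"
    "\<And>y. y \<in> topspace ?E \<Longrightarrow> (\<Sum>i<d. (y i - x i)\<^sup>2) < \<epsilon>\<^sup>2 \<Longrightarrow> y \<in> V"
    by (metis openin_Euclidean_space_ball)
  let ?B = "{y \<in> topspace ?E. (\<Sum>i<d. (y i - x i)\<^sup>2) < \<epsilon>\<^sup>2}"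
  let ?f = "\<lambda>z (i::nat). x i + \<epsilon> * z i" and ?g = "\<lambda>y (i::nat). (y i - x i) / \<epsilon>"
  have "homeomorphic_maps ?E ?E ?f ?g"
    unfolding homeomorphic_maps_def
  proof (intro conjI)
    show "continuous_map ?E ?E ?f" "continuous_map ?E ?E ?g"
      unfolding continuous_map_into_Euclidean_space using x \<epsilon>(1)
      by (auto simp: topspace_Euclidean_space
          intro!: continuous_intros continuous_map_Euclidean_space_projection)
  qed (use \<epsilon>(1) in auto)
  moreover have "(\<Sum>i<d. ((y i - x i) / \<epsilon>)\<^sup>2) < 1 \<longleftrightarrow> (\<Sum>i<d. (y i - x i)\<^sup>2) < \<epsilon>\<^sup>2" for y
    using \<epsilon>(1) by (simp add: power_divide flip: sum_divide_distrib)
  moreover have "(\<Sum>i<d. (\<epsilon> * z i)\<^sup>2) < \<epsilon>\<^sup>2 \<longleftrightarrow> (\<Sum>i<d. (z i)\<^sup>2) < 1" for z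
    using \<epsilon>(1) by (simp add: power_mult_distrib flip: sum_distrib_left)
  ultimately have "homeomorphic_maps (open_disc d) (subtopology ?E {y. (\<Sum>i<d. (y i - x i)\<^sup>2) < \<epsilon>\<^sup>2}) ?f ?g"
    unfolding open_disc_def by (intro homeomorphic_maps_subtopologies_alt) auto
  then have "subtopology ?E {y. (\<Sum>i<d. (y i - x i)\<^sup>2) < \<epsilon>\<^sup>2} homeomorphic_space open_disc d"
    using homeomorphic_space_def homeomorphic_space_sym by blast
  moreover have "subtopology ?E ?B = subtopology ?E {y. (\<Sum>i<d. (y i - x i)\<^sup>2) < \<epsilon>\<^sup>2}"
  proof -
    have "?B = topspace ?E \<inter> {y. (\<Sum>i<d. (y i - x i)\<^sup>2) < \<epsilon>\<^sup>2}"
      by blast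
    then show ?thesis
      by (simp only: subtopology_restrict)
  qed
  moreover have "x \<in> ?B"
    using x \<epsilon>(1) by simp
  ultimately show "\<exists>W. openin ?E W \<and> x \<in> W \<and> W \<subseteq> V \<and> subtopology ?E W homeomorphic_space open_disc d"
    using \<epsilon>(2) openin_Euclidean_space_round[of d x "\<epsilon>\<^sup>2"] by (intro exI[of _ ?B]) auto
qed

lemma small_nbhds_open_disc:
  assumes x: "x \<in> topspace (open_disc d)"
  shows "small_nbhds (open_disc d) x (open_disc d)"
proof -
  let ?B = "{y \<in> topspace (Euclidean_space d). (\<Sum>i<d. (y i)\<^sup>2) < 1}"
  have disc: "open_disc d = subtopology (Euclidean_space d) ?B"
  proof -
    have "?B = topspace (Euclidean_space d) \<inter> {x. (\<Sum>i<d. (x i)\<^sup>2) < 1}"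
      by blast
    then show ?thesis
      by (simp only: subtopology_restrict open_disc_def)
  qed
  have "openin (Euclidean_space d) ?B"
    using openin_Euclidean_space_round[of d "\<lambda>_. 0" 1] by simp
  then show ?thesis
    using x small_nbhds_openin[OF small_nbhds_Euclidean_space[of x d]] unfolding disc by simp
qed

lemma small_nbhds_homeomorphic_open_disc:
  assumes "X homeomorphic_space open_disc d" "x \<in> topspace X"
  shows "small_nbhds X x (open_disc d)"
proof -
  obtain h where h: "homeomorphic_map X (open_disc d) h"
    using assms(1) unfolding homeomorphic_space by blast
  have "h x \<in> topspace (open_disc d)"
    using homeomorphic_imp_surjective_map[OF h] assms(2) by blast
  then show ?thesis
    using small_nbhds_homeomorphic_map_iff[OF h assms(2)] small_nbhds_open_disc by blast
qed

text \<open>A half-space with \<open>x\<close> on its boundary is preserved by dilation about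
  \<open>x\<close>. At the others the inequality is strict at \<open>x\<close>, so it still holds
  for the dilated point once \<open>z\<close> is close enough. Finitely many half-spaces are
  involved.\<close>

lemma eventually_polyhedron_dilation:
  fixes S :: "'a::euclidean_space set"
  assumes "polyhedron S" "x \<in> S" "0 \<le> c"
  shows "\<forall>\<^sub>F z in nhds x. z \<in> S \<longrightarrow> x + c *\<^sub>R (z - x) \<in> S"
proof -
  obtain F where F: "finite F" "S = \<Inter>F" "\<And>h. h \<in> F \<Longrightarrow> \<exists>a b. h = {x. a \<bullet> x \<le> b}"
    using assms(1) unfolding polyhedron_def by metis
  have "\<forall>\<^sub>F z in nhds x. z \<in> S \<longrightarrow> x + c *\<^sub>R (z - x) \<in> h" if h: "h \<in> F" for h
  proof -
    obtain a b where ab: "h = {x. a \<bullet> x \<le> b}"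
      using F(3)[OF h] by blast
    show ?thesis
    proof (cases "a \<bullet> x = b")
      case True
      have "a \<bullet> (x + c *\<^sub>R (z - x)) \<le> b" if "z \<in> S" for z
      proof -
        have "a \<bullet> z \<le> b"
          using that h ab F(2) by auto
        then have "c * (a \<bullet> z - a \<bullet> x) \<le> 0"
          using True \<open>0 \<le> c\<close> by (simp add: mult_nonneg_nonpos)
        then show ?thesis
          using True by (simp add: inner_add_right inner_diff_right)
      qed
      then show ?thesis
        by (simp add: ab)
    next
      case False
      then have "a \<bullet> x < b"
        using h ab F(2) assms(2) by force
      moreover have "((\<lambda>z. a \<bullet> (x + c *\<^sub>R (z - x))) \<longlongrightarrow> a \<bullet> (x + c *\<^sub>R (x - x))) (nhds x)"
        by (intro tendsto_intros filterlim_ident)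
      ultimately have "\<forall>\<^sub>F z in nhds x. a \<bullet> (x + c *\<^sub>R (z - x)) < b"
        by (simp add: order_tendstoD)
      then show ?thesis
        by (rule eventually_mono) (simp add: ab)
    qed
  qed
  then have "\<forall>\<^sub>F z in nhds x. \<forall>h\<in>F. z \<in> S \<longrightarrow> x + c *\<^sub>R (z - x) \<in> h"
    by (intro eventually_ball_finite[OF F(1)]) blast
  then show ?thesis
    by (rule eventually_mono) (use F(2) in blast)
qed

section \<open>Carriers and translations in simplicial complexes\<close>

lemma simplicial_complex_polyhedron:
  assumes "simplicial_complex K" "S \<in> K"
  shows "polyhedron S" "convex S" "closed S"
  using assms simplex_imp_polyhedron polyhedron_imp_convex polyhedron_imp_closed
  unfolding simplicial_complex_def by metis+

text \<open>The intersection is a face of \<open>S\<close> that meets the relative interior of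
  \<open>S\<close>, so it is \<open>S\<close> itself.\<close>

lemma simplicial_complex_rel_interior_subset:
  assumes K: "simplicial_complex K" and "S \<in> K" "T \<in> K" and x: "x \<in> rel_interior S" "x \<in> T"
  shows "S \<subseteq> T"
proof -
  have "S \<inter> T face_of S"
    using assms unfolding simplicial_complex_def by blast
  moreover have "x \<in> (S \<inter> T) \<inter> rel_interior S"
    using x rel_interior_subset by blast
  ultimately show ?thesis
    using subset_of_face_of[of "S \<inter> T" S S] by blast
qed

text \<open>A simplex of least dimension among those containing \<open>x\<close> works: if
  \<open>x\<close> were on its relative boundary, a facet through \<open>x\<close> would have
  smaller dimension.\<close>

lemma simplicial_complex_carrier:
  fixes K :: "'a::euclidean_space set set"
  assumes K: "simplicial_complex K" and x: "x \<in> \<Union>K"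
  obtains S where "S \<in> K" "x \<in> rel_interior S"
proof -
  have "\<exists>S. S \<in> K \<and> x \<in> S"
    using x by blast
  then obtain S where S: "S \<in> K" "x \<in> S"
    and min: "\<And>T. T \<in> K \<Longrightarrow> x \<in> T \<Longrightarrow> nat (aff_dim S) \<le> nat (aff_dim T)"
    using ex_has_least_nat[of "\<lambda>S. S \<in> K \<and> x \<in> S" _ "\<lambda>S. nat (aff_dim S)"] by blast
  have "x \<in> rel_interior S"
  proof (rule ccontr)
    assume "x \<notin> rel_interior S"
    then have "x \<in> \<Union>{F. F facet_of S}"
      using S rel_boundary_of_polyhedron[OF simplicial_complex_polyhedron(1)[OF K S(1)]] by blast
    then obtain F where F: "F facet_of S" "x \<in> F"
      by blast
    then have "F \<in> K"
      using K S(1) facet_of_imp_face_of unfolding simplicial_complex_def by blast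
    moreover have "aff_dim F = aff_dim S - 1" "0 \<le> aff_dim F"
      using F aff_dim_geq[of F] aff_dim_empty[of F] unfolding facet_of_def by linarith+
    ultimately show False
      using min[of F] F(2) by linarith
  qed
  then show thesis
    using that S(1) by blast
qed

text \<open>Writing \<open>y\<close> as a convex combination of \<open>x\<close> and a point \<open>y'\<close> of the simplex exhibits the translate
  of \<open>z\<close> as a combination of \<open>y'\<close> with a dilation of \<open>z\<close> from \<open>x\<close>, and polyhedra are conical near \<open>x\<close>.\<close>

lemma eventually_translation_in_complex:
  fixes K :: "'a::euclidean_space set set"
  assumes K: "simplicial_complex K" and S: "S \<in> K" and x: "x \<in> rel_interior S" and y: "y \<in> rel_interior S"
  shows "\<forall>\<^sub>F z in nhds x. z \<in> \<Union>K \<longrightarrow> z + (y - x) \<in> \<Union>K"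
proof -
  have "x \<in> affine hull S"
    using x rel_interior_subset hull_subset by (metis subsetD)
  then obtain e where e: "e > 1" "(1 - e) *\<^sub>R x + e *\<^sub>R y \<in> S"
    using convex_rel_interior_if[OF simplicial_complex_polyhedron(2)[OF K S] y] by (meson order_refl)
  \<comment> \<open>The point \<open>y'\<close> overshoots \<open>y\<close> on the ray from
    \<open>x\<close>, so \<open>y\<close> divides the segment from \<open>x\<close> to
    \<open>y'\<close> with weight \<open>1 / e\<close> at \<open>y'\<close>. The dilation factor is
    the one with \<open>(1 - 1 / e) * c = 1\<close>, so that the displacement \<open>z - x\<close>
    comes back undistorted.\<close>
  define y' c where "y' = (1 - e) *\<^sub>R x + e *\<^sub>R y" and "c = e / (e - 1)"
  have comb: "z + (y - x) = (1 - 1 / e) *\<^sub>R (x + c *\<^sub>R (z - x)) + (1 / e) *\<^sub>R y'" for z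
  proof -
    have "(1 - 1 / e) * c = 1"
      using e(1) by (simp add: c_def field_simps)
    then have "(1 - 1 / e) *\<^sub>R (x + c *\<^sub>R (z - x)) = (1 - 1 / e) *\<^sub>R x + (z - x)"
      by (simp add: scaleR_add_right)
    moreover have "(1 / e) *\<^sub>R y' = (1 / e - 1) *\<^sub>R x + y"
      using e(1) by (simp add: y'_def scaleR_add_right diff_divide_distrib)
    ultimately show ?thesis
      by (simp add: algebra_simps)
  qed
  have "\<forall>\<^sub>F z in nhds x. z \<in> T \<longrightarrow> z + (y - x) \<in> T" if T: "T \<in> K" for T
  proof (cases "x \<in> T")
    case True
    have "y' \<in> T"
      using simplicial_complex_rel_interior_subset[OF K S T x True] e(2) by (auto simp: y'_def)
    have "0 \<le> c"
      using e(1) by (simp add: c_def)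
    from eventually_polyhedron_dilation[OF simplicial_complex_polyhedron(1)[OF K T] True this]
    show ?thesis
    proof (rule eventually_mono, intro impI)
      fix z assume "z \<in> T \<longrightarrow> x + c *\<^sub>R (z - x) \<in> T" "z \<in> T"
      then show "z + (y - x) \<in> T"
        unfolding comb using e(1) \<open>y' \<in> T\<close>
        by (intro convexD[OF simplicial_complex_polyhedron(2)[OF K T]]) auto
    qed
  next
    case False
    then have "\<forall>\<^sub>F z in nhds x. z \<in> - T"
      using simplicial_complex_polyhedron(3)[OF K T] by (intro eventually_nhds_in_open) auto
    then show ?thesis
      by (rule eventually_mono) simp
  qed
  moreover have "finite K"
    using K unfolding simplicial_complex_def by blast
  ultimately have "\<forall>\<^sub>F z in nhds x. \<forall>T\<in>K. z \<in> T \<longrightarrow> z + (y - x) \<in> T"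
    by (intro eventually_ball_finite) auto
  then show ?thesis
    by (rule eventually_mono) blast
qed

text \<open>Translations by \<open>y - x\<close> and by \<open>x - y\<close> both preserve the
  polytope locally. As they are isometries, balls of one common radius make them mutually inverse
  homeomorphisms between neighbourhoods of \<open>x\<close> and \<open>y\<close>.\<close>

proposition small_nbhds_rel_interior_homogeneous:
  fixes K :: "'a::euclidean_space set set"
  assumes K: "simplicial_complex K" and S: "S \<in> K" and x: "x \<in> rel_interior S" and y: "y \<in> rel_interior S"
    and small: "small_nbhds (top_of_set (\<Union>K)) x T"
  shows "small_nbhds (top_of_set (\<Union>K)) y T"
proof -
  let ?P = "\<Union>K"
  have xy: "x \<in> ?P" "y \<in> ?P"
    using x y S rel_interior_subset by blast+
  obtain r where r: "r > 0" "\<And>z. dist z x < r \<Longrightarrow> z \<in> ?P \<Longrightarrow> z + (y - x) \<in> ?P"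
    using eventually_translation_in_complex[OF K S x y] unfolding eventually_nhds_metric by metis
  obtain s where s: "s > 0" "\<And>z. dist z y < s \<Longrightarrow> z \<in> ?P \<Longrightarrow> z + (x - y) \<in> ?P"
    using eventually_translation_in_complex[OF K S y x] unfolding eventually_nhds_metric by metis
  define A where "A z = ?P \<inter> ball z (min r s)" for z
  have A: "openin (top_of_set ?P) (A z)" for z
    by (auto simp: A_def openin_open)
  have A_refl: "z \<in> A z" if "z \<in> ?P" for z
    using that r(1) s(1) by (simp add: A_def)
  have eq: "subtopology (top_of_set ?P) (A z) = top_of_set (A z)" for z
    by (simp add: A_def subtopology_subtopology inf_absorb2 flip: Int_assoc)
  have "homeomorphic_maps (top_of_set (A x)) (top_of_set (A y)) (\<lambda>z. z + (y - x)) (\<lambda>z. z + (x - y))"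
    unfolding homeomorphic_maps_def
  proof (intro conjI)
    have "z + (y - x) \<in> A y" if "z \<in> A x" for z
      using that r(2)[of z] unfolding A_def by (auto simp: dist_norm algebra_simps norm_minus_commute)
    then show "continuous_map (top_of_set (A x)) (top_of_set (A y)) (\<lambda>z. z + (y - x))"
      by (auto simp: continuous_map_in_subtopology intro!: continuous_intros)
    have "z + (x - y) \<in> A x" if "z \<in> A y" for z
      using that s(2)[of z] unfolding A_def by (auto simp: dist_norm algebra_simps norm_minus_commute)
    then show "continuous_map (top_of_set (A y)) (top_of_set (A x)) (\<lambda>z. z + (x - y))"
      by (auto simp: continuous_map_in_subtopology intro!: continuous_intros)
  qed auto
  then have hom: "homeomorphic_map (subtopology (top_of_set ?P) (A x)) (subtopology (top_of_set ?P) (A y))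
      (\<lambda>z. z + (y - x))"
    unfolding eq by (rule homeomorphic_maps_imp_map)
  have "small_nbhds (subtopology (top_of_set ?P) (A x)) x T"
    by (rule small_nbhds_openin[OF small A A_refl[OF xy(1)]])
  then have "small_nbhds (subtopology (top_of_set ?P) (A y)) (x + (y - x)) T"
    using small_nbhds_homeomorphic_map[OF hom, of x] A_refl[OF xy(1)] xy(1) by simp
  then show ?thesis
    using small_nbhds_subtopology[OF A A_refl[OF xy(2)] order_refl] by simp
qed

section \<open>Local structure of stratified pseudomanifolds\<close>

lemma stratified_pseudomanifoldD:
  fixes X :: "'a topology"
  assumes "stratified_pseudomanifold n X F"
  shows "F n = topspace X" "F (n - 1) = F (n - 2)" "\<And>i. i < 0 \<Longrightarrow> F i = {}"
    "\<And>k. k \<in> {0..n} \<Longrightarrow> F (n - k) - F (n - k - 1) = {} \<or>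
        topological_manifold (nat (n - k)) (subtopology X (F (n - k) - F (n - k - 1)))"
    "X closure_of (topspace X - F (n - 2)) = topspace X"
    "\<And>k x. k \<in> {0..n} \<Longrightarrow> x \<in> F (n - k) - F (n - k - 1) \<Longrightarrow>
        \<exists>(L :: 'a topology) G. stratified_pseudomanifold (k - 1) L G \<and> compact_space L \<and>
          (\<exists>U D h. distinguished_nbhd X F n k x L G U D h)"
proof -
  show "F n = topspace X"
    using assms by cases
  show "F (n - 1) = F (n - 2)"
    using assms by cases
  show "X closure_of (topspace X - F (n - 2)) = topspace X"
    using assms by cases
  have "\<forall>i<0. F i = {}"
    using assms by cases
  then show "F i = {}" if "i < 0" for i
    using that by simp
  have "\<forall>k\<in>{0..n}. F (n - k) - F (n - k - 1) = {} \<or>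
      topological_manifold (nat (n - k)) (subtopology X (F (n - k) - F (n - k - 1)))"
    using assms by cases
  then show "F (n - k) - F (n - k - 1) = {} \<or>
      topological_manifold (nat (n - k)) (subtopology X (F (n - k) - F (n - k - 1)))" if "k \<in> {0..n}" for k
    using that by (rule bspec)
  have links: "\<forall>k\<in>{0..n}. \<forall>x\<in>F (n - k) - F (n - k - 1).
      \<exists>(L :: 'a topology) G. stratified_pseudomanifold (k - 1) L G \<and> compact_space L \<and>
        (\<exists>U D h. distinguished_nbhd X F n k x L G U D h)"
    using assms by cases
  show "\<exists>(L :: 'a topology) G. stratified_pseudomanifold (k - 1) L G \<and> compact_space L \<and>
      (\<exists>U D h. distinguished_nbhd X F n k x L G U D h)"
    if "k \<in> {0..n}" "x \<in> F (n - k) - F (n - k - 1)" for k x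
    by (rule links[rule_format, OF that])
qed

lemma topspace_open_cone_empty:
  "topspace L = {} \<Longrightarrow> topspace (open_cone L) = {None}"
  by (simp add: topspace_open_cone cone_set_def)

text \<open>Of the filtration conditions the case \<open>j = k\<close> is kept. There the filtration
  of the link has index -1 and is empty, so inside \<open>U\<close> the set \<open>F (n - k)\<close>
  corresponds to \<open>D\<close> times the cone point.\<close>

lemma distinguished_nbhdE:
  fixes X :: "'a topology"
  assumes X: "stratified_pseudomanifold n X F" and k: "k \<in> {0..n}" and x: "x \<in> F (n - k) - F (n - k - 1)"
  obtains L :: "'a topology" and G V U D h where
    "stratified_pseudomanifold (k - 1) L G" "compact_space L"
    "openin X V" "x \<in> V" "V \<subseteq> U" "U \<subseteq> topspace X" "x \<in> D"
    "subtopology X D homeomorphic_space open_disc (nat (n - k))"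
    "homeomorphic_map (subtopology X U) (prod_topology (subtopology X D) (open_cone L)) h"
    "homeomorphic_map (subtopology X (U \<inter> F (n - k)))
       (prod_topology (subtopology X D) (open_cone (subtopology L {}))) h"
proof -
  obtain L :: "'a topology" and G U D h where L: "stratified_pseudomanifold (k - 1) L G" "compact_space L"
      and d: "distinguished_nbhd X F n k x L G U D h"
    using stratified_pseudomanifoldD(6)[OF X k x] by blast
  have "\<forall>j\<in>{0..k}. homeomorphic_map (subtopology X (U \<inter> F (n - j)))
       (prod_topology (subtopology X D) (open_cone (subtopology L (G (k - j - 1))))) h"
    using d unfolding distinguished_nbhd_def by blast
  then have "homeomorphic_map (subtopology X (U \<inter> F (n - k)))
       (prod_topology (subtopology X D) (open_cone (subtopology L (G (k - k - 1))))) h"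
    by (rule bspec) (use k in simp)
  moreover have "G (k - k - 1) = {}"
    using stratified_pseudomanifoldD(3)[OF L(1), of "-1"] by simp
  ultimately have "homeomorphic_map (subtopology X (U \<inter> F (n - k)))
       (prod_topology (subtopology X D) (open_cone (subtopology L {}))) h"
    by simp
  moreover obtain V where "openin X V" "x \<in> V" "V \<subseteq> U"
    using d unfolding distinguished_nbhd_def by blast
  moreover have "U \<subseteq> topspace X" "x \<in> D" "subtopology X D homeomorphic_space open_disc (nat (n - k))"
    "homeomorphic_map (subtopology X U) (prod_topology (subtopology X D) (open_cone L)) h"
    using d unfolding distinguished_nbhd_def by blast+
  ultimately show thesis
    using that[OF L] by blast
qed

lemma distinguished_nbhd_apex:
  assumes h: "homeomorphic_map (subtopology X S) (prod_topology (subtopology X D) (open_cone (subtopology L {}))) h"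
    and x: "x \<in> S" "x \<in> topspace X"
  obtains d where "h x = (d, None)" "d \<in> topspace X \<inter> D"
proof -
  have "h x \<in> topspace (prod_topology (subtopology X D) (open_cone (subtopology L {})))"
    using homeomorphic_imp_surjective_map[OF h] x by auto
  then show thesis
    using that by (auto simp: topspace_open_cone_empty)
qed

text \<open>In codimension 0 the link has dimension -1 and is empty; its cone is a point, and the
  product reduces to the disc \<open>D\<close>.\<close>

lemma top_stratum_small_nbhds:
  fixes X :: "'a topology"
  assumes X: "stratified_pseudomanifold n X F" and n: "0 \<le> n" and x: "x \<in> topspace X - F (n - 1)"
  shows "small_nbhds X x (open_disc (nat n))"
proof -
  have k: "0 \<in> {0..n}" "x \<in> F (n - 0) - F (n - 0 - 1)"
    using n x stratified_pseudomanifoldD(1)[OF X] by auto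
  obtain L :: "'a topology" and G V U D h where L: "stratified_pseudomanifold (0 - 1) L G"
    and V: "openin X V" "x \<in> V" "V \<subseteq> U" "U \<subseteq> topspace X"
    and D: "subtopology X D homeomorphic_space open_disc (nat (n - 0))"
    and h: "homeomorphic_map (subtopology X U) (prod_topology (subtopology X D) (open_cone L)) h"
    using distinguished_nbhdE[OF X k] by metis
  have "topspace L = {}"
    using stratified_pseudomanifoldD(1,3)[OF L] by simp
  then have "topspace (open_cone L) = {None}"
    by (rule topspace_open_cone_empty)
  then have "open_cone L = discrete_topology {None}"
    by (metis discrete_topology_unique openin_topspace singletonD)
  then have "prod_topology (subtopology X D) (open_cone L) homeomorphic_space subtopology X D"
    by (rule prod_topology_homeomorphic_space_left)
  then have "subtopology X U homeomorphic_space open_disc (nat n)"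
    using homeomorphic_space_trans[OF homeomorphic_map_imp_homeomorphic_space[OF h]
        homeomorphic_space_trans[OF _ D]] by simp
  then have "small_nbhds (subtopology X U) x (open_disc (nat n))"
    using V by (intro small_nbhds_homeomorphic_open_disc) auto
  then show ?thesis
    using small_nbhds_subtopology[OF V(1-3)] by blast
qed

text \<open>In codimension \<open>n\<close> the disc \<open>D\<close> has dimension 0 and is a
  single point, while \<open>U \<inter> F 0\<close> is mapped injectively to \<open>D\<close> times
  the cone point.\<close>

lemma bottom_stratum_isolated:
  fixes X :: "'a topology"
  assumes X: "stratified_pseudomanifold n X F" and n: "0 \<le> n" and x: "x \<in> F 0" "x \<in> topspace X"
  obtains V where "openin X V" "x \<in> V" "V \<inter> F 0 = {x}"
proof -
  have k: "n \<in> {0..n}" "x \<in> F (n - n) - F (n - n - 1)"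
    using n x stratified_pseudomanifoldD(3)[OF X] by auto
  obtain L :: "'a topology" and V U D h where V: "openin X V" "x \<in> V" "V \<subseteq> U" "U \<subseteq> topspace X"
    and D: "subtopology X D homeomorphic_space open_disc (nat (n - n))"
    and h: "homeomorphic_map (subtopology X (U \<inter> F (n - n)))
       (prod_topology (subtopology X D) (open_cone (subtopology L {}))) h"
    using distinguished_nbhdE[OF X k] by metis
  obtain f where f: "homeomorphic_map (subtopology X D) (open_disc (nat (n - n))) f"
    using D unfolding homeomorphic_space by blast
  have "y = x" if y: "y \<in> V" "y \<in> F 0" for y
  proof -
    have in_top: "x \<in> topspace (subtopology X (U \<inter> F (n - n)))" "y \<in> topspace (subtopology X (U \<inter> F (n - n)))"
      using y x V by auto
    obtain d where d: "h x = (d, None)" "d \<in> topspace X \<inter> D"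
      using distinguished_nbhd_apex[OF h, of x] in_top by auto
    obtain e where e: "h y = (e, None)" "e \<in> topspace X \<inter> D"
      using distinguished_nbhd_apex[OF h, of y] in_top by auto
    have "f d \<in> topspace (open_disc 0)" "f e \<in> topspace (open_disc 0)"
      using homeomorphic_imp_surjective_map[OF f] d(2) e(2) by auto
    then have "f d = f e"
      by (auto simp: open_disc_def topspace_Euclidean_space)
    then have "d = e"
      using homeomorphic_imp_injective_map[OF f] d(2) e(2) by (auto simp: inj_on_def)
    then show ?thesis
      using inj_onD[OF homeomorphic_imp_injective_map[OF h] _ in_top(2,1)] d(1) e(1) by simp
  qed
  then show thesis
    using that V x by blast
qed

text \<open>Inside \<open>U\<close> the set \<open>F 1\<close> becomes a one-dimensional disc times
  the cone point, and the only free coordinate of that disc is the injection. Continuity and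
  injectivity are what invariance of dimension asks for later.\<close>

lemma one_stratum_local_injection:
  fixes X :: "'a topology"
  assumes X: "stratified_pseudomanifold n X F" and n: "1 \<le> n" and x: "x \<in> F 1 - F 0"
  obtains V f where "openin X V" "x \<in> V" "continuous_map (subtopology X (V \<inter> F 1)) euclideanreal f"
    "inj_on f (V \<inter> F 1)"
proof -
  have k: "n - 1 \<in> {0..n}" "x \<in> F (n - (n - 1)) - F (n - (n - 1) - 1)"
    using n x by auto
  obtain L :: "'a topology" and V U D h where V: "openin X V" "x \<in> V" "V \<subseteq> U" "U \<subseteq> topspace X"
    and D: "subtopology X D homeomorphic_space open_disc (nat (n - (n - 1)))"
    and h: "homeomorphic_map (subtopology X (U \<inter> F (n - (n - 1))))
       (prod_topology (subtopology X D) (open_cone (subtopology L {}))) h"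
    using distinguished_nbhdE[OF X k] by metis
  obtain g where g: "homeomorphic_map (subtopology X D) (open_disc 1) g"
    using D unfolding homeomorphic_space by auto
  have disc: "continuous_map (open_disc 1) euclideanreal (\<lambda>z. z 0)"
    unfolding open_disc_def
    by (intro continuous_map_from_subtopology continuous_map_Euclidean_space_projection)
  have "continuous_map (subtopology X (U \<inter> F 1)) euclideanreal ((\<lambda>z. z 0) \<circ> (g \<circ> (fst \<circ> h)))"
    using continuous_map_compose[OF continuous_map_compose[OF continuous_map_compose[OF
            homeomorphic_imp_continuous_map[OF h] continuous_map_fst] homeomorphic_imp_continuous_map[OF g]] disc]
    by (simp add: o_assoc)
  then have cont: "continuous_map (subtopology X (V \<inter> F 1)) euclideanreal ((\<lambda>z. z 0) \<circ> (g \<circ> (fst \<circ> h)))"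
    using V(3) by (meson Int_mono continuous_map_from_subtopology_mono order_refl)
  have "inj_on ((\<lambda>z. z 0) \<circ> (g \<circ> (fst \<circ> h))) (V \<inter> F 1)"
  proof (rule inj_onI)
    fix y z assume yz: "y \<in> V \<inter> F 1" "z \<in> V \<inter> F 1"
      and eq: "((\<lambda>z. z 0) \<circ> (g \<circ> (fst \<circ> h))) y = ((\<lambda>z. z 0) \<circ> (g \<circ> (fst \<circ> h))) z"
    have in_top: "y \<in> topspace (subtopology X (U \<inter> F (n - (n - 1))))"
        "z \<in> topspace (subtopology X (U \<inter> F (n - (n - 1))))"
      using yz V by auto
    obtain d where d: "h y = (d, None)" "d \<in> topspace X \<inter> D"
      using distinguished_nbhd_apex[OF h, of y] in_top by auto
    obtain e where e: "h z = (e, None)" "e \<in> topspace X \<inter> D"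
      using distinguished_nbhd_apex[OF h, of z] in_top by auto
    have "g d \<in> topspace (open_disc 1)" "g e \<in> topspace (open_disc 1)"
      using homeomorphic_imp_surjective_map[OF g] d(2) e(2) by auto
    moreover have "g d 0 = g e 0"
      using eq d e by simp
    ultimately have "g d i = g e i" for i
      by (cases "i = 0") (auto simp: open_disc_def topspace_Euclidean_space)
    then have "g d = g e" ..
    then have "d = e"
      using homeomorphic_imp_injective_map[OF g] d(2) e(2) by (auto simp: inj_on_def)
    then show "y = z"
      using inj_onD[OF homeomorphic_imp_injective_map[OF h] _ in_top] d(1) e(1) by simp
  qed
  then show thesis
    using that V cont by blast
qed

section \<open>Links of points in the one-dimensional stratum\<close>

lemma Euclidean_space_1_homeomorphic: "Euclidean_space 1 homeomorphic_space euclideanreal"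
proof -
  have "homeomorphic_maps (Euclidean_space 1) euclideanreal (\<lambda>x. x 0) (\<lambda>t i. if i = 0 then t else 0)"
    unfolding homeomorphic_maps_def continuous_map_into_Euclidean_space
    by (auto simp: continuous_map_Euclidean_space_projection topspace_Euclidean_space fun_eq_iff Suc_le_eq
        simp del: One_nat_def)
  then show ?thesis
    unfolding homeomorphic_space_def by blast
qed

text \<open>A continuous injection of a compact space into a Hausdorff space is an embedding, so
  \<open>e\<close> moves the charts of the abstract manifold to its image, where the classification
  of subsets applies.\<close>

lemma compact_1_manifold_homeomorphic_circles:
  fixes L :: "'a topology" and e :: "'a \<Rightarrow> 'b::euclidean_space"
  assumes L: "topological_manifold 1 L" "compact_space L" "topspace L \<noteq> {}"
    and e: "continuous_map L euclidean e" "inj_on e (topspace L)"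
  obtains m where "1 \<le> m" "L homeomorphic_space sum_topology (\<lambda>_::nat. nsphere 1) {..<m}"
proof -
  define S where "S = e ` topspace L"
  have eh: "homeomorphic_map L (top_of_set S) e"
    using L(2) e by (intro continuous_imp_homeomorphic_map)
      (auto simp: continuous_map_in_subtopology S_def Hausdorff_space_subtopology)
  have "compact S"
    using image_compactin[of L "topspace L" euclidean e] L(2) e(1)
    by (simp add: S_def compact_space_def)
  moreover have "locally_line S"
    unfolding locally_line_def
  proof
    fix y assume "y \<in> S"
    then obtain z where z: "z \<in> topspace L" "y = e z"
      by (auto simp: S_def)
    then obtain V where V: "openin L V" "z \<in> V" "subtopology L V homeomorphic_space Euclidean_space 1"
      using L(1) unfolding topological_manifold_def by blast
    have VL: "V \<subseteq> topspace L"
      using V(1) openin_subset by blast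
    have "openin (top_of_set S) (e ` V)"
      using homeomorphic_imp_open_map[OF eh] V(1) unfolding open_map_def by blast
    moreover have "homeomorphic_map (subtopology L V) (subtopology (top_of_set S) (e ` V)) e"
      using VL by (intro homeomorphic_map_subtopologies[OF eh]) (auto simp: S_def)
    then have "subtopology L V homeomorphic_space subtopology (top_of_set S) (e ` V)"
      by (rule homeomorphic_map_imp_homeomorphic_space)
    then have "subtopology (top_of_set S) (e ` V) homeomorphic_space euclideanreal"
      by (meson V(3) Euclidean_space_1_homeomorphic homeomorphic_space_sym homeomorphic_space_trans)
    moreover have "subtopology (top_of_set S) (e ` V) = top_of_set (e ` V)"
      using VL by (auto simp: S_def subtopology_subtopology inf_absorb2 image_mono)
    ultimately show "\<exists>V. openin (top_of_set S) V \<and> y \<in> V \<and> V homeomorphic (UNIV :: real set)"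
      using V(2) z(2) by (intro exI[of _ "e ` V"]) (auto simp: homeomorphic_iff_homeomorphic_space)
  qed
  moreover have "S \<noteq> {}"
    using L(3) by (simp add: S_def)
  ultimately obtain m where "1 \<le> m" "top_of_set S homeomorphic_space sum_topology (\<lambda>_::nat. nsphere 1) {..<m}"
    by (rule compact_line_homeomorphic_circles)
  then show thesis
    using that homeomorphic_space_trans[OF homeomorphic_map_imp_homeomorphic_space[OF eh]] by blast
qed

lemma continuous_map_cone_slice:
  "continuous_map L (open_cone L) (\<lambda>z. Some (z, 1 / 2))"
proof (cases "topspace L = {}")
  case False
  have "continuous_map L (half_open_cylinder L) (\<lambda>z. (z, 1 / 2))"
    by (intro continuous_map_pairedI) (auto simp: continuous_map_in_subtopology)
  from continuous_map_compose[OF this quotient_imp_continuous_map[OF quotient_map_cone_proj[OF False]]]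
  show ?thesis
    by (simp add: o_def cone_proj_def)
qed (simp add: continuous_map_def)

text \<open>The map \<open>k\<close> will be the triangulation. Composed with the inverse of the
  distinguished chart on level \<open>1/2\<close> of the cone over one point of \<open>D\<close>, it
  injects the link into a Euclidean space.\<close>

lemma one_stratum_small_nbhds:
  fixes X :: "'a topology" and k :: "'a \<Rightarrow> 'b::euclidean_space"
  assumes X: "stratified_pseudomanifold 3 X F" and x: "x \<in> F 1 - F 0"
    and k: "continuous_map X euclidean k" "inj_on k (topspace X)"
  obtains m where "1 \<le> m"
    "small_nbhds X x (prod_topology (open_disc 1) (open_cone (sum_topology (\<lambda>_::nat. nsphere 1) {..<m})))"
proof -
  have 2: "2 \<in> {0..3::int}" "x \<in> F (3 - 2) - F (3 - 2 - 1)"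
    using x by auto
  obtain L :: "'a topology" and G V U D h where L: "stratified_pseudomanifold (2 - 1) L G" "compact_space L"
    and V: "openin X V" "x \<in> V" "V \<subseteq> U" "U \<subseteq> topspace X" and xD: "x \<in> D"
    and "subtopology X D homeomorphic_space open_disc (nat (3 - 2))"
    and h: "homeomorphic_map (subtopology X U) (prod_topology (subtopology X D) (open_cone L)) h"
    and "homeomorphic_map (subtopology X (U \<inter> F (3 - 2)))
       (prod_topology (subtopology X D) (open_cone (subtopology L {}))) h"
    by (rule distinguished_nbhdE[OF X 2])
  then have D: "subtopology X D homeomorphic_space open_disc 1"
    and h1: "homeomorphic_map (subtopology X (U \<inter> F 1))
       (prod_topology (subtopology X D) (open_cone (subtopology L {}))) h"
    by auto
  have x_top: "x \<in> topspace X"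
    using V by blast
  obtain d where d: "h x = (d, None)" "d \<in> topspace X \<inter> D"
    using distinguished_nbhd_apex[OF h1, of x] x V x_top by auto
  \<comment> \<open>With an empty link the cone equals its apex, so \<open>h\<close> has the same
    image on \<open>U\<close> and on \<open>U \<inter> F 1\<close>. Injectivity then puts the open
    set \<open>V\<close> inside \<open>F 1\<close>, against the density of the top stratum.\<close>
  have "topspace L \<noteq> {}"
  proof
    assume "topspace L = {}"
    then have "subtopology L {} = L"
      by (metis subtopology_topspace)
    then have "h ` (topspace X \<inter> U) = h ` (topspace X \<inter> (U \<inter> F 1))"
      using homeomorphic_imp_surjective_map[OF h] homeomorphic_imp_surjective_map[OF h1] by simp
    moreover have "inj_on h (topspace X \<inter> U)"
      using homeomorphic_imp_injective_map[OF h] by simp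
    ultimately have "topspace X \<inter> U = topspace X \<inter> (U \<inter> F 1)"
      by (meson Int_lower1 inf_mono inj_on_image_eq_iff order_refl)
    then have "V \<subseteq> F 1"
      using V by blast
    moreover have "x \<in> X closure_of (topspace X - F 1)"
      using stratified_pseudomanifoldD(5)[OF X] x_top by simp
    ultimately show False
      using V(1,2) unfolding in_closure_of by blast
  qed
  moreover have "topological_manifold 1 L"
  proof -
    \<comment> \<open>In dimension 1 the absence of a codimension-one stratum reads
      \<open>G 0 = G (-1)\<close>, so the whole link is its top stratum.\<close>
    have "G 1 = topspace L" "G 0 = {}"
      using stratified_pseudomanifoldD(1,2,3)[OF L(1)] by auto
    then show ?thesis
      using stratified_pseudomanifoldD(4)[OF L(1), of 0] \<open>topspace L \<noteq> {}\<close> by auto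
  qed
  moreover obtain h' where h': "homeomorphic_maps (subtopology X U) (prod_topology (subtopology X D) (open_cone L)) h h'"
    using h homeomorphic_map_maps by blast
  let ?i = "\<lambda>z. (d, Some (z, 1 / 2))"
  have i: "continuous_map L (prod_topology (subtopology X D) (open_cone L)) ?i"
    using d(2) by (intro continuous_map_pairedI continuous_map_cone_slice) auto
  have h'_cont: "continuous_map (prod_topology (subtopology X D) (open_cone L)) X h'"
    using h' by (auto simp: homeomorphic_maps_def continuous_map_in_subtopology)
  have "continuous_map L euclidean (k \<circ> (h' \<circ> ?i))"
    by (rule continuous_map_compose[OF continuous_map_compose[OF i h'_cont] k(1)])
  moreover have "inj_on (k \<circ> (h' \<circ> ?i)) (topspace L)"
  proof (intro comp_inj_on)
    have i_top: "?i ` topspace L \<subseteq> topspace (prod_topology (subtopology X D) (open_cone L))"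
      using continuous_map_image_subset_topspace[OF i] .
    show "inj_on h' (?i ` topspace L)"
      using h' i_top by (intro inj_on_inverseI[of _ h]) (auto simp: homeomorphic_maps_def)
    have "(h' \<circ> ?i) ` topspace L \<subseteq> topspace X"
      using continuous_map_image_subset_topspace[OF continuous_map_compose[OF i h'_cont]] .
    then show "inj_on k ((h' \<circ> ?i) ` topspace L)"
      using k(2) inj_on_subset by blast
  qed (simp add: inj_on_def)
  ultimately obtain m where m: "1 \<le> m" "L homeomorphic_space sum_topology (\<lambda>_::nat. nsphere 1) {..<m}"
    using compact_1_manifold_homeomorphic_circles[of L "k \<circ> (h' \<circ> ?i)"] L(2) by metis
  have "small_nbhds (subtopology X D) d (open_disc 1)"
    using d(2) by (intro small_nbhds_homeomorphic_open_disc[OF D]) auto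
  moreover have "small_nbhds (open_cone L) None (open_cone (sum_topology (\<lambda>_::nat. nsphere 1) {..<m}))"
    by (rule small_nbhds_homeomorphic_space[OF small_nbhds_open_cone_apex[OF L(2)] open_cone_homeomorphic_space[OF m(2)]])
  ultimately have "small_nbhds (prod_topology (subtopology X D) (open_cone L)) (h x)
      (prod_topology (open_disc 1) (open_cone (sum_topology (\<lambda>_::nat. nsphere 1) {..<m})))"
    unfolding d(1) by (rule small_nbhds_prod_topology)
  then have "small_nbhds (subtopology X U) x
      (prod_topology (open_disc 1) (open_cone (sum_topology (\<lambda>_::nat. nsphere 1) {..<m})))"
    using small_nbhds_homeomorphic_map_iff[OF h, of x] V x_top by auto
  then show thesis
    using that[OF m(1)] small_nbhds_subtopology[OF V(1-3)] by blast
qed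

section \<open>Intrinsic strata and carriers\<close>

text \<open>Every point of an open ball has arbitrarily small ball neighbourhoods, so one ball
  neighbourhood already yields small ones.\<close>

lemma singular_1_eq: "singular_1 X = {x \<in> topspace X. \<not> small_nbhds X x (open_disc 3)}"
proof -
  have "(\<exists>U. openin X U \<and> x \<in> U \<and> subtopology X U homeomorphic_space open_disc 3) \<longleftrightarrow>
      small_nbhds X x (open_disc 3)" if x: "x \<in> topspace X" for x
  proof
    assume "\<exists>U. openin X U \<and> x \<in> U \<and> subtopology X U homeomorphic_space open_disc 3"
    then obtain U where U: "openin X U" "x \<in> U" "subtopology X U homeomorphic_space open_disc 3"
      by blast
    then have "small_nbhds (subtopology X U) x (open_disc 3)"
      using x by (intro small_nbhds_homeomorphic_open_disc) auto
    then show "small_nbhds X x (open_disc 3)"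
      using small_nbhds_subtopology[OF U(1,2) order_refl] by blast
  next
    assume "small_nbhds X x (open_disc 3)"
    then show "\<exists>U. openin X U \<and> x \<in> U \<and> subtopology X U homeomorphic_space open_disc 3"
      using x by (auto elim: small_nbhdsE[OF _ openin_topspace])
  qed
  then show ?thesis
    unfolding singular_1_def by blast
qed

lemma closedin_singular_1: "closedin X (singular_1 X)"
proof -
  have "topspace X - singular_1 X =
      \<Union>{U. openin X U \<and> subtopology X U homeomorphic_space open_disc 3}"
    using openin_subset unfolding singular_1_def by blast
  then have "openin X (topspace X - singular_1 X)"
    by auto
  then show ?thesis
    unfolding closedin_def singular_1_def by blast
qed

text \<open>The simplices contained in \<open>Q\<close> are closed under faces. They cover
  \<open>Q\<close> because each of its points lies in the relative interior of some simplex, which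
  \<open>carrier\<close> places inside \<open>Q\<close>.\<close>

lemma subcomplex_of_carriers:
  fixes K :: "'a::euclidean_space set set"
  assumes K: "simplicial_complex K" and Q: "Q \<subseteq> \<Union>K"
    and carrier: "\<And>S x. S \<in> K \<Longrightarrow> x \<in> rel_interior S \<Longrightarrow> x \<in> Q \<Longrightarrow> S \<subseteq> Q"
    and dim: "\<And>S x. S \<in> K \<Longrightarrow> x \<in> rel_interior S \<Longrightarrow> x \<in> Q \<Longrightarrow> aff_dim S \<le> d" and d: "0 \<le> d"
  shows "\<exists>L. subcomplex L K \<and> (\<forall>S\<in>L. aff_dim S \<le> d) \<and> Q = \<Union>L"
proof (intro exI conjI ballI)
  let ?L = "{S \<in> K. S \<subseteq> Q}"
  have "simplicial_complex ?L"
    unfolding simplicial_complex_def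
  proof (intro conjI allI ballI impI)
    show "finite ?L"
      using K by (simp add: simplicial_complex_def)
    fix S assume "S \<in> ?L"
    then show "\<exists>n. n simplex S"
      using K unfolding simplicial_complex_def by blast
  next
    fix G S assume "S \<in> ?L \<and> G face_of S"
    moreover from this have "G \<subseteq> S"
      using face_of_imp_subset by blast
    ultimately show "G \<in> ?L"
      using K unfolding simplicial_complex_def by blast
  next
    fix S S' assume "S \<in> ?L \<and> S' \<in> ?L"
    then show "S \<inter> S' face_of S"
      using K unfolding simplicial_complex_def by blast
  qed
  then show "subcomplex ?L K"
    unfolding subcomplex_def by blast
  show "aff_dim S \<le> d" if S: "S \<in> ?L" for S
  proof (cases "S = {}")
    case False
    then obtain x where "x \<in> rel_interior S"
      using rel_interior_eq_empty[of S] simplicial_complex_polyhedron(2)[OF K, of S] S by auto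
    then show ?thesis
      using dim[of S x] S rel_interior_subset by blast
  \<comment> \<open>The empty simplex has no relatively interior point to which \<open>dim\<close>
    could be applied; its dimension -1 is below \<open>d\<close>.\<close>
  qed (use d in simp)
  show "Q = \<Union>?L"
  proof
    show "Q \<subseteq> \<Union>?L"
    proof
      fix x assume x: "x \<in> Q"
      then obtain S where "S \<in> K" "x \<in> rel_interior S"
        using Q simplicial_complex_carrier[OF K] by blast
      then show "x \<in> \<Union>?L"
        using carrier[of S x] x rel_interior_subset by blast
    qed
  qed blast
qed

text \<open>An open singleton would be clopen in the connected relative interior, which would then
  be a single point.\<close>

lemma rel_interior_not_isolated:
  fixes S :: "'a::euclidean_space set"
  assumes "convex S" "1 \<le> aff_dim S" "q \<in> rel_interior S"
  shows "\<not> openin (top_of_set (rel_interior S)) {q}"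
proof
  assume op: "openin (top_of_set (rel_interior S)) {q}"
  have "connected (rel_interior S)"
    using assms(1) convex_connected convex_rel_interior by blast
  moreover have "closedin (top_of_set (rel_interior S)) {q}"
    using assms(3) by (simp add: closed_subset)
  ultimately have "rel_interior S = {q}"
    using op unfolding connected_clopen by blast
  moreover have "aff_dim (rel_interior S) = aff_dim S"
    using assms(1) by (metis rel_interior_same_affine_hull aff_dim_affine_hull)
  ultimately show False
    using assms(2) by simp
qed

theorem proposition2p9:
  fixes X :: "'a topology" and F :: "int \<Rightarrow> 'a set"
    and K :: "'b::euclidean_space set set" and h :: "'a \<Rightarrow> 'b"
  assumes "stratified_pseudomanifold 3 X F" and "compact_space X"
    and "simplicial_complex K"
    and "homeomorphic_map X (top_of_set (\<Union>K)) h"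
  shows "(\<exists>L. subcomplex L K \<and> (\<forall>S \<in> L. aff_dim S \<le> 0) \<and> h ` singular_0 X = \<Union>L) \<and>
         (\<exists>L. subcomplex L K \<and> (\<forall>S \<in> L. aff_dim S \<le> 1) \<and> h ` singular_1 X = \<Union>L)"
proof -
  note X = assms(1) and K = assms(3) and h = assms(4)
  let ?P = "\<Union>K"
  have h_cont: "continuous_map X euclidean h" and h_im: "h ` topspace X = ?P" and h_inj: "inj_on h (topspace X)"
    using homeomorphic_imp_continuous_map[OF h] homeomorphic_imp_surjective_map[OF h]
      homeomorphic_imp_injective_map[OF h] by (auto simp: continuous_map_in_subtopology)
  have "finite K"
    using K unfolding simplicial_complex_def by blast
  then have P_closed: "closed ?P"
    using simplicial_complex_polyhedron(3)[OF K] by blast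
  have small_iff: "small_nbhds (top_of_set ?P) (h x) T \<longleftrightarrow> small_nbhds X x T" if "x \<in> topspace X" for x T
    using small_nbhds_homeomorphic_map_iff[OF h that] .
  have spread: "small_nbhds X y T"
    if "S \<in> K" "h x \<in> rel_interior S" "h y \<in> rel_interior S" "x \<in> topspace X" "y \<in> topspace X" "small_nbhds X x T"
    for S x y T
    using small_nbhds_rel_interior_homogeneous[OF K that(1-3)] small_iff that(4-6) by blast
  have ri_point: "\<exists>x\<in>topspace X. h x = q" if "S \<in> K" "q \<in> rel_interior S" for S q
    using that rel_interior_subset h_im by (metis UnionI imageE subsetD)
  have F3: "F 3 = topspace X" "F 2 = F 1"
    using stratified_pseudomanifoldD(1,2)[OF X] by auto
  have open_image: "openin (top_of_set (rel_interior S)) (h ` V \<inter> rel_interior S)"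
    if "openin X V" "S \<in> K" for V S
  proof -
    have "openin (top_of_set ?P) (h ` V)"
      using homeomorphic_imp_open_map[OF h] that(1) unfolding open_map_def by blast
    then obtain W where "open W" "h ` V = ?P \<inter> W"
      by (auto simp: openin_open)
    moreover have "rel_interior S \<subseteq> ?P"
      using that(2) rel_interior_subset by blast
    ultimately have "h ` V \<inter> rel_interior S = rel_interior S \<inter> W"
      by blast
    then show ?thesis
      using \<open>open W\<close> by (simp add: openin_open_Int)
  qed
  have off_F0: "\<exists>x\<in>topspace X - F 0. h x \<in> rel_interior S" if S: "S \<in> K" and dim: "1 \<le> aff_dim S" for S
  proof (rule ccontr)
    \<comment> \<open>The relative interior then corresponds to points of \<open>F 0\<close>, and an
      open set isolating one of them cuts out an open singleton.\<close>
    assume none: "\<not> ?thesis"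
    have "rel_interior S \<noteq> {}"
      using dim rel_interior_eq_empty[OF simplicial_complex_polyhedron(2)[OF K S]] by auto
    then obtain x where x: "x \<in> topspace X" "h x \<in> rel_interior S"
      using ri_point[OF S] by blast
    then have "x \<in> F 0"
      using none by blast
    then obtain V where V: "openin X V" "x \<in> V" "V \<inter> F 0 = {x}"
      using bottom_stratum_isolated[OF X _ _ x(1)] by force
    have "h ` V \<inter> rel_interior S = {h x}"
    proof
      show "h ` V \<inter> rel_interior S \<subseteq> {h x}"
      proof
        fix q assume "q \<in> h ` V \<inter> rel_interior S"
        then obtain v where v: "v \<in> V" "q = h v" "h v \<in> rel_interior S"
          by blast
        then have "v \<in> topspace X"
          using V(1) openin_subset by blast
        then have "v \<in> F 0"
          using none v(3) by blast
        then have "v \<in> {x}"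
          using V(3) v(1) by blast
        then show "q \<in> {h x}"
          using v(2) by simp
      qed
      show "{h x} \<subseteq> h ` V \<inter> rel_interior S"
        using x(2) V(2) by simp
    qed
    then show False
      using open_image[OF V(1) S] rel_interior_not_isolated[OF simplicial_complex_polyhedron(2)[OF K S] dim x(2)]
      by simp
  qed
  have off_F1: "\<exists>x\<in>topspace X - F 1. h x \<in> rel_interior S" if S: "S \<in> K" and dim: "2 \<le> aff_dim S" for S
  proof (rule ccontr)
    assume none: "\<not> ?thesis"
    \<comment> \<open>The line chart of \<open>F 1\<close> exists only around points off
      \<open>F 0\<close>, so such a point is chosen first. By assumption every nearby point of the
      relative interior comes from \<open>F 1\<close>, and the chart injects a relatively open piece
      of \<open>S\<close> into the line.\<close>
    obtain x where x: "x \<in> topspace X" "x \<notin> F 0" "h x \<in> rel_interior S"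
      using off_F0[OF S] dim by auto
    then have "x \<in> F 1 - F 0"
      using none by blast
    then obtain V f where V: "openin X V" "x \<in> V"
      and f: "continuous_map (subtopology X (V \<inter> F 1)) euclideanreal f" "inj_on f (V \<inter> F 1)"
      using one_stratum_local_injection[OF X] by auto
    obtain g where g: "homeomorphic_maps X (top_of_set ?P) h g"
      using h homeomorphic_map_maps by blast
    let ?N = "h ` V \<inter> rel_interior S"
    have N_open: "openin (top_of_set (affine hull S)) ?N"
      using open_image[OF V(1) S] openin_rel_interior openin_trans by blast
    have gh: "g (h y) = y" if "y \<in> topspace X" for y
      using g that by (auto simp: homeomorphic_maps_def)
    have g_N: "g ` ?N \<subseteq> V \<inter> F 1"
    proof
      fix y assume "y \<in> g ` ?N"
      then obtain v where "v \<in> V" "h v \<in> rel_interior S" "y = g (h v)"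
        by blast
      moreover have "v \<in> topspace X"
        using \<open>v \<in> V\<close> V(1) openin_subset by blast
      ultimately show "y \<in> V \<inter> F 1"
        using none gh by auto
    qed
    have N_P: "?N \<subseteq> ?P"
      using S rel_interior_subset by blast
    have "continuous_map (top_of_set ?N) (subtopology X (V \<inter> F 1)) g"
    proof -
      have "continuous_map (top_of_set ?P) X g"
        using g by (auto simp: homeomorphic_maps_def)
      then have "continuous_map (subtopology (top_of_set ?P) ?N) X g"
        by (rule continuous_map_from_subtopology)
      moreover have "subtopology (top_of_set ?P) ?N = top_of_set ?N"
        using N_P by (simp add: subtopology_subtopology inf_absorb2)
      ultimately show ?thesis
        using g_N by (auto simp: continuous_map_in_subtopology)
    qed
    then have "continuous_map (top_of_set ?N) euclideanreal (f \<circ> g)"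
      using f(1) by (rule continuous_map_compose)
    then have "continuous_on ?N (f \<circ> g)"
      by simp
    moreover have "inj_on (f \<circ> g) ?N"
    proof (rule comp_inj_on)
      show "inj_on g ?N"
        using g N_P by (intro inj_on_inverseI[of _ h]) (auto simp: homeomorphic_maps_def)
      show "inj_on f (g ` ?N)"
        using f(2) g_N inj_on_subset by blast
    qed
    moreover have "?N \<noteq> {}"
      using x(3) V(2) by blast
    ultimately have "aff_dim (affine hull S) \<le> aff_dim (UNIV :: real set)"
      using N_open by (intro invariance_of_dimension_affine_sets[of _ ?N]) auto
    then show False
      using dim by simp
  qed
  have disc: "small_nbhds X x (open_disc 3)" if "x \<in> topspace X - F 1" for x
    using top_stratum_small_nbhds[OF X] that F3 by auto
  have singular_1_top: "singular_1 X \<subseteq> topspace X" and singular_0_top: "singular_0 X \<subseteq> singular_1 X"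
    by (auto simp: singular_1_eq singular_0_def)
  have dim_1: "aff_dim S \<le> 1" if S: "S \<in> K" and q: "h y \<in> rel_interior S" "y \<in> singular_1 X" for S y
  proof (rule ccontr)
    assume "\<not> ?thesis"
    then obtain x where x: "x \<in> topspace X - F 1" "h x \<in> rel_interior S"
      using off_F1[OF S] by auto
    then have "small_nbhds X y (open_disc 3)"
      using spread[OF S x(2) q(1)] disc[OF x(1)] q(2) singular_1_top by blast
    then show False
      using q(2) by (simp add: singular_1_eq)
  qed
  have dim_0: "aff_dim S \<le> 0" if S: "S \<in> K" and q: "h y \<in> rel_interior S" "y \<in> singular_0 X" for S y
  proof (rule ccontr)
    assume "\<not> ?thesis"
    then obtain x where x: "x \<in> topspace X" "x \<notin> F 0" "h x \<in> rel_interior S"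
      using off_F0[OF S] by auto
    have y: "y \<in> topspace X"
      using q(2) singular_1_top singular_0_top by blast
    show False
    \<comment> \<open>Either kind of good point excludes \<open>y\<close> from \<open>X(0)\<close>:
      on \<open>F 1 - F 0\<close> by the cone neighbourhood spread to \<open>y\<close>, off
      \<open>F 1\<close> because \<open>y\<close> would not even belong to
      \<open>X(1)\<close>.\<close>
    proof (cases "x \<in> F 1")
      case True
      then obtain m where m: "1 \<le> m" "small_nbhds X x
          (prod_topology (open_disc 1) (open_cone (sum_topology (\<lambda>_::nat. nsphere 1) {..<m})))"
        using one_stratum_small_nbhds[OF X _ h_cont h_inj] x(2) by blast
      have "small_nbhds X y
          (prod_topology (open_disc 1) (open_cone (sum_topology (\<lambda>_::nat. nsphere 1) {..<m})))"
        by (rule spread[OF S x(3) q(1) x(1) y m(2)])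
      then obtain U where "openin X U" "y \<in> U" "subtopology X U homeomorphic_space
          prod_topology (open_disc 1) (open_cone (sum_topology (\<lambda>_::nat. nsphere 1) {..<m}))"
        using small_nbhdsE[OF _ openin_topspace y] by metis
      then show False
        using q(2) m(1) unfolding singular_0_def by blast
    next
      case False
      then have "small_nbhds X y (open_disc 3)"
        using spread[OF S x(3) q(1) x(1) y] disc[of x] x(1) by blast
      then show False
        using q(2) singular_0_top by (auto simp: singular_1_eq)
    qed
  qed
  have "\<exists>L. subcomplex L K \<and> (\<forall>S\<in>L. aff_dim S \<le> 0) \<and> h ` singular_0 X = \<Union>L"
  proof (rule subcomplex_of_carriers[OF K])
    show "h ` singular_0 X \<subseteq> ?P"
      using h_im singular_1_top singular_0_top by blast
    fix S q assume S: "S \<in> K" and q: "q \<in> rel_interior S" "q \<in> h ` singular_0 X"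
    then show le: "aff_dim S \<le> 0"
      using dim_0 by blast
    have "q \<in> S"
      using q(1) rel_interior_subset by blast
    \<comment> \<open>The carrier contains \<open>q\<close>, so its dimension is not -1; it is the
      vertex \<open>q\<close> and trivially lies in the image.\<close>
    then have "aff_dim S = 0"
      using le aff_dim_geq[of S] aff_dim_empty[of S] by force
    then have "S = {q}"
      using \<open>q \<in> S\<close> aff_dim_eq_0[of S] by auto
    then show "S \<subseteq> h ` singular_0 X"
      using q(2) by blast
  qed simp
  moreover have "\<exists>L. subcomplex L K \<and> (\<forall>S\<in>L. aff_dim S \<le> 1) \<and> h ` singular_1 X = \<Union>L"
  proof (rule subcomplex_of_carriers[OF K])
    show "h ` singular_1 X \<subseteq> ?P"
      using h_im singular_1_top by blast
    fix S q assume S: "S \<in> K" and q: "q \<in> rel_interior S" "q \<in> h ` singular_1 X"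
    then show "aff_dim S \<le> 1"
      using dim_1 by blast
    obtain y where y: "y \<in> singular_1 X" "q = h y"
      using q(2) by blast
    \<comment> \<open>Homogeneity in contraposed form: a manifold point over the relative interior
      would make \<open>y\<close> a manifold point too.\<close>
    have "rel_interior S \<subseteq> h ` singular_1 X"
    proof
      fix p assume p: "p \<in> rel_interior S"
      then obtain x where x: "x \<in> topspace X" "h x = p"
        using ri_point[OF S] by blast
      have "\<not> small_nbhds X x (open_disc 3)"
        using spread[OF S, of x y "open_disc 3"] x p y q(1) by (auto simp: singular_1_eq)
      then show "p \<in> h ` singular_1 X"
        using x by (auto simp: singular_1_eq)
    qed
    moreover have "closedin (top_of_set ?P) (h ` singular_1 X)"
      using homeomorphic_imp_closed_map[OF h] closedin_singular_1 unfolding closed_map_def by blast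
    then have "closed (h ` singular_1 X)"
      using P_closed closedin_closed_trans by blast
    \<comment> \<open>Passing to the closure adds the end points of an edge, whose own local type
      may differ from that of its interior.\<close>
    ultimately have "closure (rel_interior S) \<subseteq> h ` singular_1 X"
      by (rule closure_minimal)
    then show "S \<subseteq> h ` singular_1 X"
      using convex_closure_rel_interior[OF simplicial_complex_polyhedron(2)[OF K S]] closure_subset by blast
  qed simp
  ultimately show ?thesis
    by blast
qed

end
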